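(* Let $p$ be a prime, $r\ge 1$, and let $\mathcal{C}$ be a free convolutional code over $\mathbb{Z}_{p^r}$. Then $\mathcal{C}$ is noncatastrophic if and only if $\Delta_p(\mathcal{C})$ is a power of $D$. (Equivalently, this condition means that $\frac{1}{\Delta_p(\mathcal{C})}$ has finite weight.)
   Context: $\mathbb{Z}_{p^r}=\mathbb{Z}/p^r\mathbb{Z}$; $\mathbb{Z}_{p^r}((D))$ is the ring of formal Laurent series; $\mathbb{Z}_{p^r}(D)$ is the ring of rational functions $a(D)/b(D)$ with $a,b\in\mathbb{Z}_{p^r}[D]$ and the lowest-degree coefficient of $b$ a unit. A free convolutional code of length $n$ over $\mathbb{Z}_{p^r}$ is a set $\mathcal{C}=\{u(D)G(D):u(D)\in\mathbb{Z}_{p^r}((D))^k\}\subseteq\mathbb{Z}_{p^r}((D))^n$ where $G(D)\in\mathbb{Z}_{p^r}[D]^{k\times n}$ has full row rank (rows linearly independent over $\mathbb{Z}_{p^r}((D))$); such a $G(D)$ is called an encoder of $\mathcal{C}$. The weight $\mathrm{wt}$ of a series is its number of nonzero coefficients; for vectors of series the weights of the components are summed. An encoder $G(D)$ is noncatastrophic if for all $u(D)\in\mathbb{Z}_{p^r}((D))^k$: $\mathrm{wt}[u(D)G(D)]<\infty\iff\mathrm{wt}[u(D)]<\infty$; otherwise it is catastrophic. The code $\mathcal{C}$ is catastrophic if every polynomial encoder of $\mathcal{C}$ is catastrophic, and noncatastrophic otherwise. A bar denotes reduction modulo $p$. For an encoder $G(D)$, $\Delta_p(G)\in\mathbb{Z}_p[D]$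 is the (monic) greatest common divisor of the nonzero $k\times k$ minors of $\overline{G(D)}$. The internal degree of a $k\times n$ polynomial matrix is the maximum degree of its $k\times k$ minors. An encoder $G(D)$ is a reduced internal degree encoder if, among all polynomial matrices of the form $M(D)G(D)$ with $M(D)$ a $k\times k$ non-singular (i.e. invertible) matrix over $\mathbb{Z}_{p^r}(D)$, it has the minimum possible internal degree. Finally $\Delta_p(\mathcal{C}):=\Delta_p(G)$ for any reduced internal degree encoder $G(D)$ of $\mathcal{C}$; it is known that this does not depend on the choice of $G(D)$. *)

theory Defs
  imports
    "Berlekamp_Zassenhaus.Finite_Field"
    "Jordan_Normal_Form.Determinant"
    "Jordan_Normal_Form.DL_Submatrix"
    "HOL-Computational_Algebra.Computational_Algebra"
    "HOL-Library.Extended_Nat"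
begin

text \<open>
  The ring of integers modulo \<open>p ^ r\<close> is \<open>'q mod_ring\<close> for an index type \<open>'q\<close> with
  \<open>CARD('q) = CARD('p) ^ r\<close>, and its residue field is \<open>'p mod_ring\<close> with \<open>'p :: prime_card\<close>.
  Formal Laurent series are \<open>'q mod_ring fls\<close>, polynomials \<open>'q mod_ring poly\<close>.
  Matrices and vectors carry their dimensions, so the number of rows of an encoder is
  \<open>dim_row G\<close> and the length of the code is \<open>dim_col G\<close>.
\<close>

definition poly_to_fls :: "'a :: comm_ring_1 poly \<Rightarrow> 'a fls" where
  "poly_to_fls f = fps_to_fls (fps_of_poly f)"

definition laurent_mat :: "'a :: comm_ring_1 poly mat \<Rightarrow> 'a fls mat" where
  "laurent_mat G = map_mat poly_to_fls G"

text \<open>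
  Rational functions, as a subring of the Laurent series: a polynomial \<open>b\<close> whose
  lowest-degree coefficient is a unit is invertible there, so \<open>f * b = a\<close> determines
  \<open>f = a / b\<close>.
\<close>

definition ratfuns :: "'a :: comm_ring_1 fls set" where
  "ratfuns = {f. \<exists>a b. b \<noteq> 0 \<and> coeff b (LEAST i. coeff b i \<noteq> 0) dvd 1 \<and>
                    f * poly_to_fls b = poly_to_fls a}"

definition nonsingular_ratfun_mat :: "nat \<Rightarrow> 'a :: comm_ring_1 fls mat \<Rightarrow> bool" where
  "nonsingular_ratfun_mat k M \<longleftrightarrow>
     M \<in> carrier_mat k k \<and> elements_mat M \<subseteq> ratfuns \<and>
     (\<exists>N \<in> carrier_mat k k. elements_mat N \<subseteq> ratfuns \<and>
        M * N = 1\<^sub>m k \<and> N * M = 1\<^sub>m k)"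


text \<open>The row vector \<open>u G\<close>, expressed through the column product with the transpose.\<close>

definition encode :: "'a :: comm_ring_1 poly mat \<Rightarrow> 'a fls vec \<Rightarrow> 'a fls vec" where
  "encode G u = transpose_mat (laurent_mat G) *\<^sub>v u"

definition full_row_rank :: "'a :: comm_ring_1 poly mat \<Rightarrow> bool" where
  "full_row_rank G \<longleftrightarrow>
     (\<forall>u \<in> carrier_vec (dim_row G). encode G u = 0\<^sub>v (dim_col G) \<longrightarrow> u = 0\<^sub>v (dim_row G))"

definition encoder :: "'a :: comm_ring_1 fls vec set \<Rightarrow> 'a poly mat \<Rightarrow> bool" where
  "encoder C G \<longleftrightarrow> full_row_rank G \<and> C = encode G ` carrier_vec (dim_row G)"

definition free_convolutional_code :: "nat \<Rightarrow> 'a :: comm_ring_1 fls vec set \<Rightarrow> bool" where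
  "free_convolutional_code n C \<longleftrightarrow> (\<exists>G. dim_col G = n \<and> encoder C G)"


definition fls_wt :: "'a :: zero fls \<Rightarrow> enat" where
  "fls_wt f = (let S = {i. fls_nth f i \<noteq> 0} in if finite S then enat (card S) else \<infinity>)"

definition wt :: "'a :: zero fls vec \<Rightarrow> enat" where
  "wt v = (\<Sum>i<dim_vec v. fls_wt (v $ i))"

definition noncatastrophic_encoder :: "'a :: comm_ring_1 poly mat \<Rightarrow> bool" where
  "noncatastrophic_encoder G \<longleftrightarrow>
     (\<forall>u \<in> carrier_vec (dim_row G). wt (encode G u) < \<infinity> \<longleftrightarrow> wt u < \<infinity>)"

definition catastrophic_code :: "'a :: comm_ring_1 fls vec set \<Rightarrow> bool" where
  "catastrophic_code C \<longleftrightarrow> (\<forall>G. encoder C G \<longrightarrow> \<not> noncatastrophic_encoder G)"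


definition full_minors :: "'a :: comm_ring_1 mat \<Rightarrow> 'a set" where
  "full_minors A =
     {det (submatrix A UNIV J) | J. J \<subseteq> {..<dim_col A} \<and> card J = dim_row A}"

definition internal_degree :: "'a :: comm_ring_1 poly mat \<Rightarrow> nat" where
  "internal_degree G = Max (degree ` full_minors G)"

definition reduced_internal_degree_encoder ::
    "'a :: comm_ring_1 fls vec set \<Rightarrow> 'a poly mat \<Rightarrow> bool" where
  "reduced_internal_degree_encoder C G \<longleftrightarrow> encoder C G \<and>
     (\<forall>M H. nonsingular_ratfun_mat (dim_row G) M \<and> laurent_mat H = M * laurent_mat G \<longrightarrow>
        internal_degree G \<le> internal_degree H)"


text \<open>
  Reduction modulo \<open>p\<close>; it is a ring homomorphism only if \<open>CARD('p)\<close> divides \<open>CARD('q)\<close>.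
\<close>

definition reduce_mod :: "'q :: nontriv mod_ring \<Rightarrow> 'p :: prime_card mod_ring" where
  "reduce_mod x = of_int_mod_ring (to_int_mod_ring x)"

definition reduce_mat :: "'q :: nontriv mod_ring poly mat \<Rightarrow> 'p :: prime_card mod_ring poly mat" where
  "reduce_mat G = map_mat (map_poly reduce_mod) G"

text \<open>\<open>Gcd\<close> on polynomials over a field is normalised to be monic (or zero).\<close>

definition Delta_encoder :: "'q :: nontriv mod_ring poly mat \<Rightarrow> 'p :: prime_card mod_ring poly" where
  "Delta_encoder G = Gcd (full_minors (reduce_mat G :: 'p mod_ring poly mat) - {0})"

text \<open>
  The value does not depend on the reduced internal degree encoder that is chosen.
\<close>

definition Delta_code ::
    "'q :: nontriv mod_ring fls vec set \<Rightarrow> 'p :: prime_card mod_ring poly" where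
  "Delta_code C = Delta_encoder (SOME G. reduced_internal_degree_encoder C G)"

end

theory Submission
  imports Defs
begin

text \<open>
  Write \<open>R\<close> for the integers modulo \<open>p\<^sup>r\<close>. If \<open>\<Delta>\<^sub>p(G)\<close> is a power of \<open>D\<close>, a Bezout relation between the minors
  gives a right inverse of the reduction of \<open>G\<close> up to a power of \<open>D\<close>; it lifts along the nilpotent
  ideal \<open>(p)\<close>, so \<open>G\<close> is noncatastrophic. If some \<open>s\<close> prime to \<open>D\<close> divides all reduced minors, McCoy's
  theorem modulo \<open>s\<close> produces an input \<open>p\<^sup>r\<^sup>-\<^sup>1 u / s\<close> of infinite weight with polynomial output.

  It remains to compare a noncatastrophic encoder \<open>G\<close> with a reduced internal degree encoder \<open>G'\<close>.
  Noncatastrophicity makes the matrix \<open>T\<close> in \<open>G' = T G\<close> a Laurent polynomial matrix. Modulo \<open>p\<close> one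
  splits a power of \<open>D\<close> times \<open>T\<close> as \<open>S H\<close> with \<open>det S\<close> prime to \<open>D\<close> and \<open>det H\<close> a power of \<open>D\<close>, and the
  factorisation lifts to \<open>R\<close> by Hensel's lemma. Cancelling \<open>S\<close> from \<open>G'\<close> leaves a polynomial encoder of
  smaller internal degree unless \<open>det S\<close> is constant modulo \<open>p\<close>; hence it is constant, and
  \<open>\<Delta>\<^sub>p(G')\<close> divides a power of \<open>D\<close>.
\<close>

no_notation fps_nth (infixl "$" 75)

section \<open>Minors and McCoy's theorem\<close>

text \<open>
  The last row is handled by bordering a minor of the first \<open>k\<close> rows that is not killed by \<open>c\<close> with
  a further column \<open>j\<close>: the cofactors along that column do not depend on \<open>j\<close>. Arbitrary column
  selections \<open>\<sigma>\<close> are allowed because the bordered selection is neither sorted nor injective.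
\<close>

lemma mccoy_ideal_aux:
  fixes a :: "nat \<Rightarrow> nat \<Rightarrow> 'a::comm_ring_1"
  assumes I: "\<And>x y. x \<in> I \<Longrightarrow> y * x \<in> I" and c: "c \<notin> I"
    and minors: "\<And>\<sigma>. (\<forall>l<k. \<sigma> l < n) \<Longrightarrow> c * det (mat k k (\<lambda>(i, l). a i (\<sigma> l))) \<in> I"
  shows "\<exists>u. (\<exists>i<k. u i \<notin> I) \<and> (\<forall>j<n. (\<Sum>i<k. u i * a i j) \<in> I)"
  using minors
proof (induction k)
  case 0
  \<comment> \<open>The empty determinant is 1, so the hypothesis would put \<open>c\<close> itself
    into \<open>I\<close>.\<close>
  from 0[of id] c show ?case by (simp add: det_dim_zero)
next
  case (Suc k)
  show ?case
  proof (cases "\<forall>\<sigma>. (\<forall>l<k. \<sigma> l < n) \<longrightarrow> c * det (mat k k (\<lambda>(i, l). a i (\<sigma> l))) \<in> I")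
    case True
    with Suc.IH obtain u where u: "\<exists>i<k. u i \<notin> I" "\<forall>j<n. (\<Sum>i<k. u i * a i j) \<in> I" by blast
    have "(\<Sum>i<Suc k. (u(k := 0)) i * a i j) = (\<Sum>i<k. u i * a i j)" for j
      by simp
    with u show ?thesis by (intro exI[of _ "u(k := 0)"]) (use less_SucI in fastforce)
  next
    case False
    then obtain \<sigma> where \<sigma>: "\<forall>l<k. \<sigma> l < n"
      and nz: "c * det (mat k k (\<lambda>(i, l). a i (\<sigma> l))) \<notin> I" by blast
    define B where "B j = mat (Suc k) (Suc k) (\<lambda>(i, l). a i ((\<sigma>(k := j)) l))" for j
    have B: "B j \<in> carrier_mat (Suc k) (Suc k)" for j by (simp add: B_def)
    have del: "mat_delete (B j) i k = mat_delete (B 0) i k" for i j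
      by (rule eq_matI) (auto simp: mat_delete_def B_def)
    define u where "u i = c * cofactor (B 0) i k" for i
    have "(\<Sum>i<Suc k. u i * a i j) \<in> I" if "j < n" for j
    proof -
      have "c * det (B j) \<in> I"
        unfolding B_def by (rule Suc.prems) (use \<sigma> that in auto)
      moreover have "det (B j) = (\<Sum>i<Suc k. B j $$ (i, k) * cofactor (B j) i k)"
        by (rule laplace_expansion_column[OF B]) simp
      moreover have "B j $$ (i, k) = a i j" if "i < Suc k" for i
        using that by (simp add: B_def)
      ultimately show ?thesis
        by (simp add: u_def cofactor_def del[of j] sum_distrib_left ac_simps distrib_left)
    qed
    moreover have "mat_delete (B 0) k k = mat k k (\<lambda>(i, l). a i (\<sigma> l))"
      by (rule eq_matI) (auto simp: mat_delete_def B_def)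
    \<comment> \<open>The last coefficient is exactly \<open>c\<close> times the minor chosen
      outside \<open>I\<close>; its sign has the even exponent \<open>k + k\<close>.\<close>
    then have "u k \<notin> I" using nz by (simp add: u_def cofactor_def flip: mult_2)
    ultimately show ?thesis by blast
  qed
qed

text \<open>Columns are selected by an arbitrary function, possibly unsorted or with repetitions,
  because that is what the induction for McCoy's theorem produces. The sorted selections
  \<open>pick J\<close> give back \<open>full_minors\<close>.\<close>

definition col_minor :: "'a::comm_ring_1 mat \<Rightarrow> (nat \<Rightarrow> nat) \<Rightarrow> 'a" where
  "col_minor A \<sigma> = det (mat (dim_row A) (dim_row A) (\<lambda>(i, l). A $$ (i, \<sigma> l)))"

lemma full_minors_eq:
  "full_minors A =
     (\<lambda>J. col_minor A (pick J)) ` {J. J \<subseteq> {..<dim_col A} \<and> card J = dim_row A}"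
proof -
  have "det (submatrix A UNIV J) = col_minor A (pick J)"
    if "J \<subseteq> {..<dim_col A}" "card J = dim_row A" for J
  proof -
    have "{j. j < dim_col A \<and> j \<in> J} = J" using that by auto
    then show ?thesis using that by (simp add: submatrix_def col_minor_def pick_UNIV)
  qed
  then show ?thesis unfolding full_minors_def by (auto simp: image_def) metis
qed

lemma finite_full_minors: "finite (full_minors A)"
proof -
  have "full_minors A \<subseteq> (\<lambda>J. col_minor A (pick J)) ` Pow {..<dim_col A}"
    unfolding full_minors_eq by auto
  then show ?thesis by (rule finite_subset) simp
qed

lemma pick_less:
  assumes "J \<subseteq> {..<n}" "card J = k" "l < k"
  shows "pick J l < n"
  using pick_in_set[of l J] assms by auto

text \<open>A repeated column makes the determinant 0, hence the inserted 0: there may be no full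
  minors at all. Without repetition the selected columns are a permutation of \<open>pick J\<close>,
  and \<open>s\<close> is its sign.\<close>

lemma col_minor_full_minors:
  assumes \<sigma>: "\<forall>l<dim_row A. \<sigma> l < dim_col A"
  shows "\<exists>s. \<exists>m\<in>insert 0 (full_minors A). col_minor A \<sigma> = s * m"
proof (cases "inj_on \<sigma> {..<dim_row A}")
  case False
  then obtain i j where ij: "i < dim_row A" "j < dim_row A" "i \<noteq> j" "\<sigma> i = \<sigma> j"
    by (auto simp: inj_on_def)
  have "col_minor A \<sigma> = 0" unfolding col_minor_def
    by (rule det_identical_columns[OF _ ij(3) ij(1,2)]) (use ij in \<open>auto intro: eq_vecI\<close>)
  then show ?thesis by auto
next
  case True
  let ?k = "dim_row A"
  define J where "J = \<sigma> ` {..<?k}"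
  have J: "J \<subseteq> {..<dim_col A}" "card J = ?k"
    using \<sigma> True by (auto simp: J_def card_image)
  have fJ: "finite J" by (simp add: J_def)
  have bij: "bij_betw (pick J) {..<?k} J"
  proof -
    have inj: "inj_on (pick J) {..<?k}"
      unfolding inj_on_def by (metis J(2) lessThan_iff linorder_neqE_nat nat_neq_iff pick_mono)
    moreover have "pick J ` {..<?k} \<subseteq> J" using pick_in_set J by auto
    ultimately show ?thesis
      by (simp add: bij_betw_def card_subset_eq[OF fJ] card_image J)
  qed
  \<comment> \<open>The position of column \<open>\<sigma> l\<close> in the increasing enumeration
    of \<open>J\<close>, continued by the identity as \<open>permutes\<close> demands.\<close>
  define \<pi> where "\<pi> l = (if l < ?k then the_inv_into {..<?k} (pick J) (\<sigma> l) else l)" for l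
  have b1: "bij_betw \<sigma> {..<?k} J" using True by (simp add: J_def bij_betw_def)
  have "bij_betw (the_inv_into {..<?k} (pick J) \<circ> \<sigma>) {..<?k} {..<?k}"
    using bij_betw_trans[OF b1 bij_betw_the_inv_into[OF bij]] .
  then have "bij_betw \<pi> {..<?k} {..<?k}"
    by (rule bij_betw_cong[THEN iffD1, rotated]) (simp add: \<pi>_def)
  then have perm: "\<pi> permutes {0..<?k}"
    by (intro bij_imp_permutes) (auto simp: \<pi>_def atLeast0LessThan)
  have \<pi>\<sigma>: "\<pi> l < ?k \<and> pick J (\<pi> l) = \<sigma> l" if "l < ?k" for l
  proof -
    have "\<sigma> l \<in> pick J ` {..<?k}" using that bij by (simp add: bij_betw_def J_def)
    then show ?thesis using that f_the_inv_into_f[of "pick J" "{..<?k}" "\<sigma> l"]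
      the_inv_into_into[of "pick J" "{..<?k}" "\<sigma> l" "{..<?k}"] bij
      by (auto simp: \<pi>_def bij_betw_def)
  qed
  \<comment> \<open>Transposed, since the permutation rule for determinants acts on rows.\<close>
  define B where "B = transpose_mat (mat ?k ?k (\<lambda>(i, l). A $$ (i, pick J l)))"
  have B: "B \<in> carrier_mat ?k ?k" by (simp add: B_def)
  have dB: "det B = col_minor A (pick J)"
    unfolding B_def by (subst det_transpose[of _ ?k]) (auto simp: col_minor_def)
  have "col_minor A \<sigma> = det (transpose_mat (mat ?k ?k (\<lambda>(i, j). B $$ (\<pi> i, j))))"
    unfolding col_minor_def by (rule arg_cong[of _ _ det], rule eq_matI) (auto simp: B_def \<pi>\<sigma>)
  also have "\<dots> = det (mat ?k ?k (\<lambda>(i, j). B $$ (\<pi> i, j)))"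
    by (rule det_transpose[of _ ?k]) simp
  also have "\<dots> = signof \<pi> * det B" by (rule det_permute_rows[OF B perm])
  finally show ?thesis using J dB unfolding full_minors_eq by auto
qed

text \<open>McCoy's theorem relative to \<open>I\<close>: the case \<open>I = {0}\<close> yields
  linear dependence of rows, and the multiples of a polynomial yield dependence modulo it. The
  multiplier \<open>c\<close> covers minors that are merely annihilated by a common nonzero
  element.\<close>

lemma mccoy_ideal:
  fixes A :: "'a::comm_ring_1 mat"
  assumes A: "A \<in> carrier_mat k n"
    and I: "\<And>x y. x \<in> I \<Longrightarrow> y * x \<in> I" and "0 \<in> I" and c: "c \<notin> I"
    and minors: "\<And>m. m \<in> full_minors A \<Longrightarrow> c * m \<in> I"
  obtains u where "u \<in> carrier_vec k" "\<exists>i<k. u $ i \<notin> I"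
    "\<And>j. j < n \<Longrightarrow> (transpose_mat A *\<^sub>v u) $ j \<in> I"
proof -
  have "c * det (mat k k (\<lambda>(i, l). A $$ (i, \<sigma> l))) \<in> I" if "\<forall>l<k. \<sigma> l < n" for \<sigma>
  proof -
    have "\<exists>s. \<exists>m\<in>insert 0 (full_minors A). col_minor A \<sigma> = s * m"
      by (rule col_minor_full_minors) (use A that in auto)
    then obtain s m where sm: "m \<in> insert 0 (full_minors A)" "col_minor A \<sigma> = s * m"
      by blast
    have "c * m \<in> I" using sm minors \<open>0 \<in> I\<close> by auto
    from I[OF this, of s] show ?thesis using sm A by (simp add: col_minor_def ac_simps)
  qed
  from mccoy_ideal_aux[of I c k n "\<lambda>i j. A $$ (i, j)", OF I c this] obtain u where u:
    "\<exists>i<k. u i \<notin> I" "\<forall>j<n. (\<Sum>i<k. u i * A $$ (i, j)) \<in> I" by blast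
  show thesis
  proof (rule that[of "vec k u"])
    fix j assume j: "j < n"
    have "(transpose_mat A *\<^sub>v vec k u) $ j = (\<Sum>i<k. u i * A $$ (i, j))"
      using A j by (simp add: scalar_prod_def atLeast0LessThan mult.commute)
    then show "(transpose_mat A *\<^sub>v vec k u) $ j \<in> I" using u(2) j by simp
  qed (use u in auto)
qed

lemma col_minor_mult:
  fixes S :: "'a::comm_ring_1 mat"
  assumes S: "S \<in> carrier_mat k k" and A: "A \<in> carrier_mat k n" and \<sigma>: "\<forall>l<k. \<sigma> l < n"
  shows "col_minor (S * A) \<sigma> = det S * col_minor A \<sigma>"
proof -
  have "mat k k (\<lambda>(i, l). (S * A) $$ (i, \<sigma> l)) = S * mat k k (\<lambda>(i, l). A $$ (i, \<sigma> l))"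
    by (rule eq_matI) (use S A \<sigma> in \<open>auto simp: scalar_prod_def\<close>)
  then show ?thesis using S A by (simp add: col_minor_def det_mult[of _ k])
qed

lemma full_minors_mult:
  fixes S :: "'a::comm_ring_1 mat"
  assumes S: "S \<in> carrier_mat k k" and A: "A \<in> carrier_mat k n"
  shows "full_minors (S * A) = (*) (det S) ` full_minors A"
proof -
  have "col_minor (S * A) (pick J) = det S * col_minor A (pick J)"
    if "J \<subseteq> {..<n}" "card J = k" for J
    by (rule col_minor_mult[OF S A]) (use pick_less that in blast)
  then show ?thesis using S A unfolding full_minors_eq image_image by (intro image_cong) auto
qed

lemma (in comm_ring_hom) full_minors_hom:
  "full_minors (map_mat hom A) = hom ` full_minors A"
proof -
  have "col_minor (map_mat hom A) (pick J) = hom (col_minor A (pick J))"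
    if "J \<subseteq> {..<dim_col A}" "card J = dim_row A" for J
  proof -
    have "mat (dim_row A) (dim_row A) (\<lambda>(i, l). map_mat hom A $$ (i, pick J l)) =
      map_mat hom (mat (dim_row A) (dim_row A) (\<lambda>(i, l). A $$ (i, pick J l)))"
      by (rule eq_matI) (use pick_less[OF that] in auto)
    then show ?thesis by (simp add: col_minor_def)
  qed
  then show ?thesis unfolding full_minors_eq image_image by (intro image_cong) auto
qed

lemma full_minors_smult:
  assumes A: "A \<in> carrier_mat k n"
  shows "full_minors (c \<cdot>\<^sub>m A) = (*) (c ^ k) ` full_minors A"
proof -
  have "c \<cdot>\<^sub>m A = (c \<cdot>\<^sub>m 1\<^sub>m k) * A" using A by (simp add: mult_smult_assoc_mat[of _ k k])
  then show ?thesis using full_minors_mult[of "c \<cdot>\<^sub>m 1\<^sub>m k" k A n] A by simp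
qed

text \<open>The 0-1 matrix \<open>E\<close> selects the columns \<open>J\<close>, so
  \<open>A * E\<close> is the square matrix \<open>B\<close> of the minor, and
  \<open>B * adj_mat B\<close> is \<open>det B\<close> times the identity.\<close>

lemma full_minor_right_factor:
  fixes A :: "'a::comm_ring_1 mat"
  assumes A: "A \<in> carrier_mat k n" and m: "m \<in> full_minors A"
  shows "\<exists>K\<in>carrier_mat n k. A * K = m \<cdot>\<^sub>m 1\<^sub>m k"
proof -
  from m obtain J where J: "J \<subseteq> {..<n}" "card J = k" and mJ: "m = col_minor A (pick J)"
    using A unfolding full_minors_eq by auto
  define E :: "'a mat" where "E = mat n k (\<lambda>(i, l). if i = pick J l then 1 else 0)"
  define B where "B = mat k k (\<lambda>(i, l). A $$ (i, pick J l))"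
  have E: "E \<in> carrier_mat n k" and B: "B \<in> carrier_mat k k" by (auto simp: E_def B_def)
  have "A * E = B"
    by (rule eq_matI) (use A pick_less[OF J] in
        \<open>auto simp: E_def B_def scalar_prod_def if_distrib cong: if_cong\<close>)
  then have "A * (E * adj_mat B) = m \<cdot>\<^sub>m 1\<^sub>m k"
    using A B E adj_mat[OF B] assoc_mult_mat[OF A E adj_mat(1)[OF B]] mJ
    by (simp add: B_def col_minor_def)
  then show ?thesis using E adj_mat(1)[OF B] by (intro bexI[of _ "E * adj_mat B"]) auto
qed

section \<open>Lifting along a nilpotent ideal\<close>

lemma (in comm_ring_hom) mat_hom_smult: "map_mat hom (c \<cdot>\<^sub>m A) = hom c \<cdot>\<^sub>m map_mat hom A"
  by (rule eq_matI) (auto simp: hom_mult)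

text \<open>Abstracts the map from the integers modulo a prime power to the residue field, so that
  the same lifting lemmas serve for coefficients and for polynomials.\<close>

locale nilpotent_reduction = comm_ring_hom red
  for red :: "'a::comm_ring_1 \<Rightarrow> 'b::comm_ring_1" +
  fixes \<pi> :: 'a and N :: nat
  assumes surj_red: "surj red"
    and red_eq_0_iff: "red x = 0 \<longleftrightarrow> \<pi> dvd x"
    and nilpotent: "\<pi> ^ N = 0"
begin

lemma red_\<pi> [simp]: "red \<pi> = 0"
  by (simp add: red_eq_0_iff)

lemma red_eqD: "red x = red y \<Longrightarrow> \<exists>z. x = y + \<pi> * z"
  using red_eq_0_iff[of "x - y"] by (auto simp: hom_minus dvd_def algebra_simps)

text \<open>An inverse modulo \<open>\<pi>\<close> is improved step by step until the error carries
  the factor \<open>\<pi> ^ Suc N\<close>, which is 0.\<close>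

lemma unit_if_red_unit:
  assumes "red x dvd 1"
  shows "x dvd 1"
proof -
  obtain y where y: "red (x * y) = red 1"
    using assms surj_red by (metis dvdE hom_mult hom_one surjD)
  have "\<exists>y z. x * y = 1 + \<pi> ^ Suc i * z" for i
  proof (induction i)
    case 0
    from red_eqD[OF y] show ?case by auto
  next
    case (Suc i)
    then obtain y z where "x * y = 1 + \<pi> ^ Suc i * z" by blast
    then have "(x * y) * (1 - \<pi> ^ Suc i * z) = (1 + \<pi> ^ Suc i * z) * (1 - \<pi> ^ Suc i * z)"
      by simp
    \<comment> \<open>The error is squared, but only one additional factor \<open>\<pi>\<close> is
      recorded.\<close>
    then have "x * (y * (1 - \<pi> ^ Suc i * z)) = 1 + \<pi> ^ Suc (Suc i) * (- (\<pi> ^ i) * z * z)"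
      by (simp add: algebra_simps)
    then show ?case by blast
  qed
  from this[of N] obtain y where "x * y = 1" by (auto simp: nilpotent)
  then show ?thesis by (metis dvd_triv_left)
qed

lemma lift_mat:
  assumes "B \<in> carrier_mat m n"
  obtains A where "A \<in> carrier_mat m n" "map_mat red A = B"
proof
  show "map_mat (inv_into UNIV red) B \<in> carrier_mat m n" using assms by simp
  show "map_mat red (map_mat (inv_into UNIV red) B) = B"
    by (rule eq_matI) (auto simp: surj_f_inv_f[OF surj_red])
qed

lemma lift_vec:
  assumes "v \<in> carrier_vec n"
  obtains w where "w \<in> carrier_vec n" "map_vec red w = v"
proof
  show "map_vec (inv_into UNIV red) v \<in> carrier_vec n" using assms by simp
  show "map_vec red (map_vec (inv_into UNIV red) v) = v"
    by (rule eq_vecI) (auto simp: surj_f_inv_f[OF surj_red])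
qed

lemma map_mat_eqD:
  assumes A: "A \<in> carrier_mat m n" and B: "B \<in> carrier_mat m n"
    and eq: "map_mat red A = map_mat red B"
  obtains E where "E \<in> carrier_mat m n" "A = B + \<pi> \<cdot>\<^sub>m E"
proof -
  have "\<exists>z. A $$ (i, j) = B $$ (i, j) + \<pi> * z" if "i < m" "j < n" for i j
    by (rule red_eqD) (use arg_cong[OF eq, of "\<lambda>M. M $$ (i, j)"] A B that in auto)
  then obtain z where "\<And>i j. i < m \<Longrightarrow> j < n \<Longrightarrow> A $$ (i, j) = B $$ (i, j) + \<pi> * z i j" by metis
  then have "A = B + \<pi> \<cdot>\<^sub>m mat m n (\<lambda>(i, j). z i j)"
    by (intro eq_matI) (use A B in auto)
  then show thesis by (intro that[of "mat m n (\<lambda>(i, j). z i j)"]) auto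
qed

text \<open>If \<open>G * K\<close> is a scalar matrix \<open>M\<close> plus an error
  \<open>q E\<close>, multiplying by \<open>M - q E\<close> on the right gives \<open>M * M\<close>
  minus \<open>q * q\<close> times \<open>E * E\<close>, as \<open>M\<close> commutes with
  \<open>E\<close>. Each round squares the error and doubles the exponent of \<open>c\<close>, which
  is why \<open>a\<close> is left unspecified.\<close>

lemma right_factor_lift:
  assumes G: "G \<in> carrier_mat k n" and K: "K \<in> carrier_mat n k"
    and GK: "map_mat red G * K = red c \<cdot>\<^sub>m 1\<^sub>m k"
  shows "\<exists>a. \<exists>K\<in>carrier_mat n k. G * K = c ^ a \<cdot>\<^sub>m 1\<^sub>m k"
proof -
  have "\<exists>a. \<exists>K\<in>carrier_mat n k. \<exists>E\<in>carrier_mat k k.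
    G * K = c ^ a \<cdot>\<^sub>m 1\<^sub>m k + \<pi> ^ Suc i \<cdot>\<^sub>m E" for i
  proof (induction i)
    case 0
    obtain K' where K': "K' \<in> carrier_mat n k" "map_mat red K' = K" using lift_mat[OF K] .
    have "map_mat red (G * K') = map_mat red (c \<cdot>\<^sub>m 1\<^sub>m k)"
      using mat_hom_mult[OF G K'(1)] K'(2) GK by (simp add: mat_hom_smult mat_hom_one)
    with map_mat_eqD[of "G * K'" k k "c \<cdot>\<^sub>m 1\<^sub>m k"] G K' obtain E where
      "E \<in> carrier_mat k k" "G * K' = c \<cdot>\<^sub>m 1\<^sub>m k + \<pi> \<cdot>\<^sub>m E"
      by (metis mult_carrier_mat one_carrier_mat smult_carrier_mat)
    then show ?case using K' by (intro exI[of _ 1] bexI[of _ K'] bexI[of _ E]) auto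
  next
    case (Suc i)
    then obtain a K E where K: "K \<in> carrier_mat n k" and E: "E \<in> carrier_mat k k"
      and GK: "G * K = c ^ a \<cdot>\<^sub>m 1\<^sub>m k + \<pi> ^ Suc i \<cdot>\<^sub>m E" by blast
    define q M L where "q = \<pi> ^ Suc i" and "M = c ^ a \<cdot>\<^sub>m 1\<^sub>m k" and "L = M - q \<cdot>\<^sub>m E"
    have M: "M \<in> carrier_mat k k" and L: "L \<in> carrier_mat k k"
      using E by (auto simp: M_def L_def)
    have EL: "E * L = c ^ a \<cdot>\<^sub>m E - q \<cdot>\<^sub>m (E * E)"
      unfolding L_def M_def using E
      by (subst mult_minus_distrib_mat[of _ k k _ k]) (auto simp: mult_smult_distrib)
    have LM: "M * L = c ^ a \<cdot>\<^sub>m L"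
      unfolding M_def using L by (simp add: mult_smult_assoc_mat[of _ k k])
    have "G * (K * L) = (M + q \<cdot>\<^sub>m E) * L"
      using assoc_mult_mat[OF G K L] GK by (simp add: q_def M_def)
    also have "\<dots> = M * L + q \<cdot>\<^sub>m (E * L)"
      using M E L by (simp add: add_mult_distrib_mat[of _ k k] mult_smult_assoc_mat[of _ k k])
    also have "\<dots> = c ^ (2 * a) \<cdot>\<^sub>m 1\<^sub>m k + \<pi> ^ Suc (Suc i) \<cdot>\<^sub>m (- (\<pi> ^ i) \<cdot>\<^sub>m (E * E))"
      unfolding EL LM using E
      by (intro eq_matI)
        (auto simp del: index_mult_mat simp: index_mult_mat(2,3) L_def M_def q_def power_mult power2_eq_square mult.commute[of 2] algebra_simps)
    finally show ?case using K L E
      by (intro exI[of _ "2 * a"] bexI[of _ "K * L"] bexI[of _ "- (\<pi> ^ i) \<cdot>\<^sub>m (E * E)"]) auto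
  qed
  from this[of N] obtain a K E where "K \<in> carrier_mat n k" "E \<in> carrier_mat k k"
    "G * K = c ^ a \<cdot>\<^sub>m 1\<^sub>m k + 0 \<cdot>\<^sub>m E" by (auto simp: nilpotent)
  moreover from this have "c ^ a \<cdot>\<^sub>m 1\<^sub>m k + 0 \<cdot>\<^sub>m E = c ^ a \<cdot>\<^sub>m 1\<^sub>m k"
    by (intro eq_matI) auto
  ultimately show ?thesis by metis
qed

text \<open>
  Hensel lifting: the Bezout relation between the determinants solves the linearised equation
  \<open>S Y + X H = E\<close> by \<open>X = a E adj(H)\<close> and \<open>Y = b adj(S) E\<close>.
\<close>

lemma mat_factorization_lift:
  assumes T: "T \<in> carrier_mat k k" and S: "S \<in> carrier_mat k k" and H: "H \<in> carrier_mat k k"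
    and SH: "map_mat red T = S * H" and bez: "a * det H + b * det S = 1"
  shows "\<exists>S'\<in>carrier_mat k k. \<exists>H'\<in>carrier_mat k k. T = S' * H' \<and> map_mat red S' = S"
proof -
  obtain a' b' where ab: "red a' = a" "red b' = b" using surj_red by (metis surjD)
  have "\<exists>S'\<in>carrier_mat k k. \<exists>H'\<in>carrier_mat k k. \<exists>E\<in>carrier_mat k k.
    T = S' * H' + \<pi> ^ Suc i \<cdot>\<^sub>m E \<and> map_mat red S' = S \<and> map_mat red H' = H" for i
  proof (induction i)
    case 0
    obtain S' where S': "S' \<in> carrier_mat k k" "map_mat red S' = S" using lift_mat[OF S] .
    obtain H' where H': "H' \<in> carrier_mat k k" "map_mat red H' = H" using lift_mat[OF H] .
    have "map_mat red T = map_mat red (S' * H')"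
      using mat_hom_mult[OF S'(1) H'(1)] S' H' SH by simp
    with map_mat_eqD[OF T, of "S' * H'"] obtain E where
      "E \<in> carrier_mat k k" "T = S' * H' + \<pi> \<cdot>\<^sub>m E"
      using S' H' by (metis mult_carrier_mat)
    then show ?case using S' H' by (intro bexI[of _ S'] bexI[of _ H'] bexI[of _ E]) auto
  next
    case (Suc i)
    then obtain S' H' E where S': "S' \<in> carrier_mat k k" "map_mat red S' = S"
      and H': "H' \<in> carrier_mat k k" "map_mat red H' = H" and E: "E \<in> carrier_mat k k"
      and TE: "T = S' * H' + \<pi> ^ Suc i \<cdot>\<^sub>m E" by blast
    have "red (a' * det H' + b' * det S') = red 1"
      using bez ab S'(2) H'(2) by (simp add: hom_add hom_mult flip: hom_det)
    then obtain z where z: "a' * det H' + b' * det S' = 1 + \<pi> * z" using red_eqD by blast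
    define q X Y where "q = \<pi> ^ Suc i" and "X = a' \<cdot>\<^sub>m (E * adj_mat H')"
      and "Y = b' \<cdot>\<^sub>m (adj_mat S' * E)"
    note adjH = adj_mat[OF H'(1)] and adjS = adj_mat[OF S'(1)]
    have X: "X \<in> carrier_mat k k" and Y: "Y \<in> carrier_mat k k"
      using adjH(1) adjS(1) E by (auto simp: X_def Y_def)
    have XH: "X * H' = (a' * det H') \<cdot>\<^sub>m E"
    proof -
      have "X * H' = a' \<cdot>\<^sub>m (E * (adj_mat H' * H'))"
        unfolding X_def using E H' adjH(1)
        by (simp add: mult_smult_assoc_mat[of _ k k] assoc_mult_mat[of _ k k _ k _ k])
      also have "\<dots> = a' \<cdot>\<^sub>m (det H' \<cdot>\<^sub>m E)"
        unfolding adjH(3) using E by (simp add: mult_smult_distrib[of _ k k _ k])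
      finally show ?thesis using E by (intro eq_matI) (auto simp: ac_simps)
    qed
    have SY: "S' * Y = (b' * det S') \<cdot>\<^sub>m E"
    proof -
      have "S' * Y = b' \<cdot>\<^sub>m (S' * adj_mat S' * E)"
        unfolding Y_def using E S' adjS(1)
        by (simp add: mult_smult_distrib[of _ k k _ k] assoc_mult_mat[of _ k k _ k _ k])
      also have "\<dots> = b' \<cdot>\<^sub>m (det S' \<cdot>\<^sub>m E)"
        unfolding adjS(2) using E by (simp add: mult_smult_assoc_mat[of _ k k])
      finally show ?thesis using E by (intro eq_matI) (auto simp: ac_simps)
    qed
    have XY: "X * Y \<in> carrier_mat k k" and SH': "S' * H' \<in> carrier_mat k k"
      using X Y S' H' by auto
    have "(S' + q \<cdot>\<^sub>m X) * (H' + q \<cdot>\<^sub>m Y) =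
        (S' * H' + q \<cdot>\<^sub>m (X * H')) + (q \<cdot>\<^sub>m (S' * Y) + q \<cdot>\<^sub>m (q \<cdot>\<^sub>m (X * Y)))"
      using X Y S'(1) H'(1)
      by (simp add: mult_add_distrib_mat[of _ k k _ k] add_mult_distrib_mat[of _ k k _ _ k]
          mult_smult_distrib[of _ k k _ k] mult_smult_assoc_mat[of _ k k _ k]
          add_smult_distrib_left_mat[of _ k k])
    then have *: "(S' + q \<cdot>\<^sub>m X) * (H' + q \<cdot>\<^sub>m Y) =
        (S' * H' + q \<cdot>\<^sub>m ((a' * det H') \<cdot>\<^sub>m E)) +
        (q \<cdot>\<^sub>m ((b' * det S') \<cdot>\<^sub>m E) + q \<cdot>\<^sub>m (q \<cdot>\<^sub>m (X * Y)))"
      unfolding XH SY .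
    \<comment> \<open>The new product exceeds \<open>T\<close> by \<open>q * \<pi> * z\<close> times
      \<open>E\<close>, from the inexact lift of the Bezout relation, and by \<open>q * q\<close>
      times \<open>X * Y\<close>; \<open>E'\<close> compensates both after
      \<open>\<pi> ^ Suc (Suc i)\<close> is taken out.\<close>
    define E' where "E' = - z \<cdot>\<^sub>m E + - (\<pi> ^ i) \<cdot>\<^sub>m (X * Y)"
    have "T = (S' + q \<cdot>\<^sub>m X) * (H' + q \<cdot>\<^sub>m Y) + \<pi> ^ Suc (Suc i) \<cdot>\<^sub>m E'"
    proof (rule eq_matI)
      fix l j assume "l < dim_row ((S' + q \<cdot>\<^sub>m X) * (H' + q \<cdot>\<^sub>m Y) + \<pi> ^ Suc (Suc i) \<cdot>\<^sub>m E')"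
        "j < dim_col ((S' + q \<cdot>\<^sub>m X) * (H' + q \<cdot>\<^sub>m Y) + \<pi> ^ Suc (Suc i) \<cdot>\<^sub>m E')"
      then have lj: "l < k" "j < k" using E XY by (auto simp: E'_def)
      define t e y where "t = (S' * H') $$ (l, j)" and "e = E $$ (l, j)" and "y = (X * Y) $$ (l, j)"
      have "((S' + q \<cdot>\<^sub>m X) * (H' + q \<cdot>\<^sub>m Y) + \<pi> ^ Suc (Suc i) \<cdot>\<^sub>m E') $$ (l, j) =
        t + q * (a' * det H' * e) + (q * (b' * det S' * e) + q * (q * y)) +
        \<pi> ^ Suc (Suc i) * (- z * e + - (\<pi> ^ i) * y)"
        unfolding * E'_def t_def e_def y_def using E X Y S' H' lj by (simp del: index_mult_mat(1) power_Suc)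
      also have "\<dots> = t + q * ((a' * det H' + b' * det S') * e) + q * (q * y)
        + \<pi> ^ Suc (Suc i) * (- z * e + - (\<pi> ^ i) * y)" by (simp add: algebra_simps)
      also have "\<dots> = t + q * e"
        unfolding z q_def by (simp add: algebra_simps)
      finally show "T $$ (l, j) =
        ((S' + q \<cdot>\<^sub>m X) * (H' + q \<cdot>\<^sub>m Y) + \<pi> ^ Suc (Suc i) \<cdot>\<^sub>m E') $$ (l, j)"
        using TE E S' H' lj by (simp del: index_mult_mat(1) power_Suc add: t_def e_def q_def)
    qed (use T E XY in \<open>auto simp: E'_def\<close>)
    moreover have "map_mat red (S' + q \<cdot>\<^sub>m X) = S" "map_mat red (H' + q \<cdot>\<^sub>m Y) = H"
      unfolding S'(2)[symmetric] H'(2)[symmetric]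
      by (rule eq_matI; use S' H' X Y in \<open>auto simp: q_def hom_add hom_mult\<close>)+
    moreover have "E' \<in> carrier_mat k k" using E XY by (simp add: E'_def)
    ultimately show ?case using S'(1) H'(1) X Y
      by (intro bexI[of _ "S' + q \<cdot>\<^sub>m X"] bexI[of _ "H' + q \<cdot>\<^sub>m Y"] bexI[of _ E']) auto
  qed
  from this[of N] obtain S' H' E where S': "S' \<in> carrier_mat k k" "map_mat red S' = S"
    and H': "H' \<in> carrier_mat k k" and "E \<in> carrier_mat k k"
    and "T = S' * H' + 0 \<cdot>\<^sub>m E" by (auto simp: nilpotent)
  then have "T = S' * H'" by (intro eq_matI) auto
  then show ?thesis using S' H' by blast
qed

end

section \<open>Polynomial matrices\<close>

lemma X_poly_prime: "prime_elem ([:0, 1:] :: 'a::{field_gcd} poly)"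
  by (rule prime_elem_linear_field_poly) simp

lemma coprime_X_power:
  fixes s :: "'a::{field_gcd} poly"
  assumes "poly s 0 \<noteq> 0"
  shows "coprime ([:0, 1:] ^ m) s"
proof -
  have "\<not> [:0, 1:] dvd s" using assms by (auto simp: dvd_def)
  then have "coprime [:0, 1:] s"
    by (rule prime_elem_imp_coprime[OF X_poly_prime])
  then show ?thesis by simp
qed

lemma X_power_decomposition:
  fixes f :: "'a::{field_gcd} poly"
  assumes "f \<noteq> 0"
  obtains m s where "f = [:0, 1:] ^ m * s" "poly s 0 \<noteq> 0"
proof -
  from order_decomp[OF assms, of 0] obtain q where
    "f = [:0, 1:] ^ order 0 f * q" "\<not> [:0, 1:] dvd q" by auto
  then show thesis using that by (auto simp: poly_eq_0_iff_dvd)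
qed

text \<open>Once the power of the indeterminate is split off, the cofactor is coprime to it and
  hence a unit; normalisation makes this unit 1.\<close>

lemma dvd_X_power:
  fixes f :: "'a::{field_gcd} poly"
  assumes dvd: "f dvd [:0, 1:] ^ N" and norm: "normalize f = f"
  shows "\<exists>m. f = [:0, 1:] ^ m"
proof -
  have "f \<noteq> 0" using dvd by auto
  then obtain m s where f: "f = [:0, 1:] ^ m * s" and s: "poly s 0 \<noteq> 0"
    by (rule X_power_decomposition)
  have "s dvd [:0, 1:] ^ N" using dvd f by (metis dvd_mult_right)
  with coprime_X_power[OF s, of N] have "is_unit s"
    by (metis coprime_absorb_right coprime_commute is_unit_normalize not_coprimeI dvd_refl coprime_common_divisor)
  then have "normalize s = 1" by (simp add: is_unit_normalize)
  moreover have "normalize [:0, 1:] = ([:0, 1:] :: 'a poly)"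
    by (simp add: normalize_poly_def flip: one_pCons)
  then have "normalize ([:0, 1:] ^ m :: 'a poly) = [:0, 1:] ^ m"
    by (simp only: normalize_power)
  ultimately show ?thesis using norm f by (metis mult.right_neutral normalize_mult)
qed

lemma Gcd_in_ideal:
  fixes M :: "'a::euclidean_ring_gcd set"
  assumes "finite M" and "0 \<in> I" and "\<And>x y a b. x \<in> I \<Longrightarrow> y \<in> I \<Longrightarrow> a * x + b * y \<in> I"
    and "M \<subseteq> I"
  shows "Gcd M \<in> I"
  using assms(1,4)
proof (induction M)
  case (insert x M)
  have "Gcd (insert x M) = fst (bezout_coefficients x (Gcd M)) * x
      + snd (bezout_coefficients x (Gcd M)) * Gcd M"
    by (simp add: bezout_coefficients_fst_snd)
  then show ?case using insert assms(3) by simp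
qed (use assms(2) in simp)

text \<open>The scalars \<open>c\<close> for which some \<open>K\<close> satisfies
  \<open>A * K = c\<close> times the identity form an ideal. It contains every full minor, and
  therefore also their gcd.\<close>

lemma Gcd_minors_right_factor:
  fixes A :: "'a::{field_gcd} poly mat"
  assumes A: "A \<in> carrier_mat k n"
  shows "\<exists>K\<in>carrier_mat n k. A * K = Gcd (full_minors A - {0}) \<cdot>\<^sub>m 1\<^sub>m k"
proof -
  define I where "I = {c. \<exists>K\<in>carrier_mat n k. A * K = c \<cdot>\<^sub>m 1\<^sub>m k}"
  have "Gcd (full_minors A - {0}) \<in> I"
  proof (rule Gcd_in_ideal)
    show "finite (full_minors A - {0})" by (simp add: finite_full_minors)
    show "0 \<in> I" using A unfolding I_def
      by (auto intro!: bexI[of _ "0\<^sub>m n k"] eq_matI)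
    show "full_minors A - {0} \<subseteq> I"
      using full_minor_right_factor[OF A] by (auto simp: I_def)
    fix x y a b :: "'a poly" assume "x \<in> I" "y \<in> I"
    then obtain K L where K: "K \<in> carrier_mat n k" "A * K = x \<cdot>\<^sub>m 1\<^sub>m k"
      and L: "L \<in> carrier_mat n k" "A * L = y \<cdot>\<^sub>m 1\<^sub>m k" by (auto simp: I_def)
    have "A * (a \<cdot>\<^sub>m K + b \<cdot>\<^sub>m L) = a \<cdot>\<^sub>m (A * K) + b \<cdot>\<^sub>m (A * L)"
      using A K(1) L(1) by (simp add: mult_add_distrib_mat[of _ k n _ k] mult_smult_distrib[of _ k n _ k])
    also have "\<dots> = (a * x + b * y) \<cdot>\<^sub>m 1\<^sub>m k"
      unfolding K(2) L(2) by (rule eq_matI) auto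
    finally show "a * x + b * y \<in> I" using K(1) L(1)
      by (auto simp: I_def intro!: bexI[of _ "a \<cdot>\<^sub>m K + b \<cdot>\<^sub>m L"])
  qed
  then show ?thesis by (simp add: I_def)
qed

text \<open>
  A kernel vector of \<open>T(0)\<close>, normalised to have \<open>i\<close>-th entry 1, gives a combination of the
  columns of \<open>T\<close> that is divisible by the indeterminate; it replaces the \<open>i\<close>-th column.
\<close>

lemma split_off_X:
  fixes T :: "'a::field poly mat"
  assumes T: "T \<in> carrier_mat k k" and det0: "poly (det T) 0 = 0"
  shows "\<exists>B\<in>carrier_mat k k. \<exists>H\<in>carrier_mat k k. T = B * H \<and> det H = [:0, 1:]"
proof -
  have ev: "comm_ring_hom (\<lambda>p :: 'a poly. poly p 0)" by unfold_locales auto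
  define T0 where "T0 = map_mat (\<lambda>p. poly p 0) T"
  have T0: "T0 \<in> carrier_mat k k" using T by (simp add: T0_def)
  have "det T0 = 0" using comm_ring_hom.hom_det[OF ev, of T] det0 by (simp only: T0_def)
  then obtain v where v: "v \<in> carrier_vec k" "v \<noteq> 0\<^sub>v k" "T0 *\<^sub>v v = 0\<^sub>v k"
    using det_0_iff_vec_prod_zero_field[OF T0] by blast
  then obtain i where i: "i < k" "v $ i \<noteq> 0" by (auto simp: vec_eq_iff)
  define c where "c j = v $ j / v $ i" for j
  have ci: "c i = 1" using i by (simp add: c_def)
  define w where "w l = (\<Sum>j<k. T $$ (l, j) * [:c j:])" for l
  have "\<exists>b. w l = [:0, 1:] * b" if l: "l < k" for l
  proof -
    have "poly (w l) 0 = (\<Sum>j<k. T0 $$ (l, j) * v $ j) / v $ i"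
      using T l by (simp add: w_def c_def poly_sum T0_def sum_divide_distrib mult.commute)
    also have "(\<Sum>j<k. T0 $$ (l, j) * v $ j) = (T0 *\<^sub>v v) $ l"
      using T0 v(1) l by (simp add: scalar_prod_def atLeast0LessThan)
    also have "(T0 *\<^sub>v v) $ l = 0" using v l by simp
    finally show ?thesis by (simp add: poly_eq_0_iff_dvd dvd_def)
  qed
  then obtain b where b: "\<And>l. l < k \<Longrightarrow> w l = [:0, 1:] * b l" by metis
  \<comment> \<open>\<open>B\<close> is \<open>T\<close> with column \<open>i\<close> replaced by
    the quotient \<open>b\<close>. \<open>H\<close> is the identity except in column
    \<open>i\<close>, where it multiplies \<open>b\<close> by the indeterminate and subtracts the
    other columns with weights \<open>c\<close>, which leaves column \<open>i\<close> of
    \<open>T\<close> because \<open>c i = 1\<close>.\<close>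
  define B where "B = mat k k (\<lambda>(l, j). if j = i then b l else T $$ (l, j))"
  define H where "H = mat k k (\<lambda>(l, j). if j = i then (if l = i then [:0, 1:] else [:- c l:])
    else (if l = j then 1 else 0))"
  have B: "B \<in> carrier_mat k k" and H: "H \<in> carrier_mat k k" by (auto simp: B_def H_def)
  have "T = B * H"
  proof (rule eq_matI)
    fix l j assume "l < dim_row (B * H)" "j < dim_col (B * H)"
    then have lj: "l < k" "j < k" using B H by auto
    have BH: "(B * H) $$ (l, j) = (\<Sum>m<k. B $$ (l, m) * H $$ (m, j))"
      using B H lj by (simp add: scalar_prod_def atLeast0LessThan)
    show "T $$ (l, j) = (B * H) $$ (l, j)"
    proof (cases "j = i")
      case False
      then have "(\<Sum>m<k. B $$ (l, m) * H $$ (m, j)) = (\<Sum>m<k. if m = j then T $$ (l, j) else 0)"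
        using lj by (intro sum.cong) (auto simp: B_def H_def)
      then show ?thesis using lj BH by simp
    next
      case True
      have "(\<Sum>m<k. B $$ (l, m) * H $$ (m, j)) =
        (\<Sum>m<k. (if m = i then w l + T $$ (l, i) else 0) - T $$ (l, m) * [:c m:])"
        using lj True b[OF lj(1)] ci by (intro sum.cong) (auto simp: B_def H_def)
      also have "\<dots> = T $$ (l, i)" using i by (simp add: sum_subtractf w_def)
      finally show ?thesis using BH True by simp
    qed
  qed (use T B H in auto)
  moreover have "det H = [:0, 1:]"
  proof -
    \<comment> \<open>Row \<open>i\<close> of \<open>H\<close> has its only nonzero entry on the
      diagonal, so expansion along it leaves one term.\<close>
    have "mat_delete H i i = 1\<^sub>m (k - 1)"
      by (rule eq_matI) (auto simp: mat_delete_def H_def)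
    then have "cofactor H i i = 1" by (simp add: cofactor_def flip: mult_2)
    moreover have "det H = (\<Sum>j<k. H $$ (i, j) * cofactor H i j)"
      by (rule laplace_expansion_row[OF H i(1)])
    moreover have "\<dots> = (\<Sum>j<k. if j = i then [:0, 1:] * cofactor H i i else 0)"
      using i by (intro sum.cong) (auto simp: H_def)
    ultimately show ?thesis using i by simp
  qed
  ultimately show ?thesis using B H by blast
qed

text \<open>Each application of \<open>split_off_X\<close> removes one factor of the determinant and
  lowers its degree; the split-off matrices collect on the right.\<close>

lemma split_off_X_power:
  fixes T :: "'a::field poly mat"
  assumes "T \<in> carrier_mat k k" and "det T \<noteq> 0"
  shows "\<exists>S\<in>carrier_mat k k. \<exists>H\<in>carrier_mat k k. \<exists>j.
    T = S * H \<and> poly (det S) 0 \<noteq> 0 \<and> det H = [:0, 1:] ^ j"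
  using assms
proof (induction "degree (det T)" arbitrary: T rule: less_induct)
  case less
  show ?case
  proof (cases "poly (det T) 0 = 0")
    case False
    then show ?thesis using less.prems
      by (intro bexI[of _ T] bexI[of _ "1\<^sub>m k"] exI[of _ 0]) auto
  next
    case True
    then obtain B H where B: "B \<in> carrier_mat k k" and H: "H \<in> carrier_mat k k"
      and T: "T = B * H" and dH: "det H = [:0, 1:]"
      using split_off_X[OF less.prems(1)] by blast
    have dT: "det T = det B * [:0, 1:]" using det_mult[OF B H] T dH by simp
    then have nz: "det B \<noteq> 0" using less.prems by auto
    then have "degree (det B) < degree (det T)" unfolding dT by (subst degree_mult_eq) auto
    from less.hyps[OF this B nz] obtain S H' j where S: "S \<in> carrier_mat k k"
      and H': "H' \<in> carrier_mat k k" and *: "B = S * H'" "poly (det S) 0 \<noteq> 0"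
      "det H' = [:0, 1:] ^ j" by blast
    have "T = S * (H' * H)" using T * assoc_mult_mat[OF S H' H] by simp
    moreover have "det (H' * H) = [:0, 1:] ^ Suc j" using det_mult[OF H' H] * dH by simp
    ultimately show ?thesis using * S H H'
      by (intro bexI[of _ S] bexI[of _ "H' * H"] exI[of _ "Suc j"]) auto
  qed
qed

text \<open>Pseudo-division scales \<open>f\<close> by a power of the leading coefficient of
  \<open>g\<close>; the same power of its inverse undoes this, so division works in spite of zero
  divisors.\<close>

lemma poly_division_unit_lead_coeff:
  fixes f g :: "'a::comm_ring_1 poly"
  assumes g: "lead_coeff g dvd 1" and "g \<noteq> 0"
  obtains q r where "f = g * q + r" "r = 0 \<or> degree r < degree g"
proof -
  obtain c where c: "lead_coeff g * c = 1" using g by (metis dvdE)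
  obtain q r where qr: "pseudo_divmod f g = (q, r)" by force
  define m where "m = Suc (degree f) - degree g"
  have *: "smult (lead_coeff g ^ m) f = g * q + r" "r = 0 \<or> degree r < degree g"
    using pseudo_divmod[OF \<open>g \<noteq> 0\<close> qr] by (auto simp: m_def)
  have "f = smult (c ^ m) (smult (lead_coeff g ^ m) f)"
    using c by (simp add: mult.commute flip: power_mult_distrib)
  also have "\<dots> = g * smult (c ^ m) q + smult (c ^ m) r" by (simp add: * smult_add_right)
  finally show thesis using that *(2) by (metis degree_smult_le le_less_trans smult_0_right)
qed

lemma const_dvd_poly_iff:
  fixes f :: "'a::comm_ring_1 poly"
  shows "[:c:] dvd f \<longleftrightarrow> (\<forall>i. c dvd coeff f i)"
proof
  assume "\<forall>i. c dvd coeff f i"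
  then show "[:c:] dvd f"
  proof (induction f)
    case (pCons a f)
    then have "\<forall>i. c dvd coeff f i" by (metis coeff_pCons_Suc)
    with pCons obtain g where "f = [:c:] * g" by (auto simp: dvd_def)
    moreover have "c dvd a" using pCons.prems by (metis coeff_pCons_0)
    then obtain b where "a = c * b" by (auto simp: dvd_def)
    ultimately have "pCons a f = [:c:] * pCons b g" by simp
    then show ?case by (metis dvd_triv_left)
  qed simp
qed (auto simp: dvd_def)

context nilpotent_reduction
begin

lemma nilpotent_reduction_poly: "nilpotent_reduction (map_poly red) [:\<pi>:] N"
proof -
  interpret mp: map_poly_comm_ring_hom red ..
  have "\<exists>g. map_poly red g = f" for f
  proof (rule exI, rule poly_eqI)
    \<comment> \<open>The chosen preimage of 0 could be a nonzero multiple of \<open>\<pi>\<close>;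
      the conditional sends 0 to 0, as coefficientwise mapping requires.\<close>
    show "coeff (map_poly red (map_poly (\<lambda>x. if x = 0 then 0 else inv_into UNIV red x) f)) i = coeff f i" for i
      by (simp add: coeff_map_poly surj_f_inv_f[OF surj_red])
  qed
  then have "surj (map_poly red)" by (metis surjI)
  moreover have "map_poly red f = 0 \<longleftrightarrow> [:\<pi>:] dvd f" for f
    by (simp add: poly_eq_iff coeff_map_poly red_eq_0_iff const_dvd_poly_iff)
  moreover have "[:\<pi>:] ^ N = 0" by (simp add: poly_const_pow nilpotent)
  ultimately show ?thesis by unfold_locales
qed

end

text \<open>The model is \<open>\<pi> = p\<close> and \<open>e = p\<^sup>r\<^sup>-\<^sup>1\<close> in the integers modulo \<open>p\<^sup>r\<close>.\<close>

locale chain_reduction = nilpotent_reduction red \<pi> N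
  for red :: "'a::comm_ring_1 \<Rightarrow> 'b::{field_gcd}" and \<pi> N +
  fixes e :: 'a
  assumes socle: "e * x = 0 \<longleftrightarrow> red x = 0"
    and annihilator: "\<pi> * x = 0 \<Longrightarrow> e dvd x"
begin

abbreviation pred :: "'a poly \<Rightarrow> 'b poly" where "pred \<equiv> map_poly red"

sublocale poly: nilpotent_reduction pred "[:\<pi>:]" N
  by (rule nilpotent_reduction_poly)

lemma unit_iff: "x dvd 1 \<longleftrightarrow> red x \<noteq> 0"
proof
  assume "x dvd 1"
  then have "red x dvd 1" by (metis hom_dvd hom_one)
  then show "red x \<noteq> 0" by auto
qed (simp add: unit_if_red_unit dvd_field_iff)

lemma poly_socle: "[:e:] * f = 0 \<longleftrightarrow> pred f = 0"
  by (simp add: poly_eq_iff socle)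

lemma poly_annihilator: "[:\<pi>:] * f = 0 \<Longrightarrow> [:e:] dvd f"
  by (auto simp: poly_eq_iff const_dvd_poly_iff intro: annihilator)

text \<open>The top coefficients of \<open>s\<close> may be nilpotent. Starting from a lift
  \<open>s'\<close> of \<open>pred s\<close> of the same degree, the error \<open>y\<close> is
  divided by \<open>s'\<close>; the remainder is absorbed into \<open>s'\<close>, the quotient into
  the unit, and what is left has a higher power of \<open>\<pi>\<close>.\<close>

lemma weierstrass_preparation:
  assumes "pred s \<noteq> 0"
  shows "\<exists>u. u dvd 1 \<and> degree (u * s) = degree (pred s) \<and> lead_coeff (u * s) dvd 1"
proof -
  define d where "d = degree (pred s)"
  \<comment> \<open>Every approximation \<open>s'\<close> keeps degree \<open>d\<close> and
    reduction \<open>pred s\<close>, so its leading coefficient stays a unit and division by it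
    stays possible.\<close>
  have lc: "lead_coeff f dvd 1 \<and> f \<noteq> 0" if "degree f = d" "pred f = pred s" for f
  proof -
    have "red (lead_coeff f) = lead_coeff (pred s)"
      using that by (metis coeff_map_poly d_def hom_zero)
    moreover have "lead_coeff (pred s) \<noteq> 0" using assms leading_coeff_0_iff by blast
    ultimately have "red (lead_coeff f) \<noteq> 0" by metis
    then show ?thesis using assms that(2) by (auto simp: unit_iff)
  qed
  have "\<exists>u s' y. u dvd 1 \<and> u * s = s' + [:\<pi>:] ^ Suc i * y \<and> degree s' = d \<and> pred s' = pred s"
    for i
  proof (induction i)
    case 0
    define s' where "s' = map_poly (\<lambda>x. if x = 0 then 0 else inv_into UNIV red x) (pred s)"
    have *: "pred s' = pred s"
      by (rule poly_eqI) (simp add: s'_def coeff_map_poly surj_f_inv_f[OF surj_red])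
    have "degree s' \<le> d" unfolding s'_def d_def by (rule degree_map_poly_le)
    moreover have "d \<le> degree s'" unfolding d_def *[symmetric] by (rule degree_map_poly_le)
    moreover obtain z where "s = s' + [:\<pi>:] * z" using poly.red_eqD[of s s'] * by auto
    ultimately show ?case using *
      by (intro exI[of _ 1] exI[of _ s'] exI[of _ z]) auto
  next
    case (Suc i)
    then obtain u s' y where u: "u dvd 1" and s': "degree s' = d" "pred s' = pred s"
      and us: "u * s = s' + [:\<pi>:] ^ Suc i * y" by blast
    define P where "P = [:\<pi>:] ^ Suc i"
    obtain q \<rho> where y: "y = s' * q + \<rho>" and \<rho>: "\<rho> = 0 \<or> degree \<rho> < d"
      using poly_division_unit_lead_coeff[of s'] lc[OF s'] s' by metis
    have redP: "pred P = 0"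
      unfolding P_def power_Suc poly.hom_mult poly.red_\<pi> by simp
    have "(1 - P * q) * u dvd 1"
    proof -
      have "pred (1 - P * q) dvd 1" by (simp add: poly.hom_minus poly.hom_mult redP)
      then show ?thesis using u poly.unit_if_red_unit by (meson is_unit_mult_iff)
    qed
    moreover have "(1 - P * q) * u * s = (s' + P * \<rho>) + [:\<pi>:] ^ Suc (Suc i) * (- ([:\<pi>:] ^ i) * q * y)"
    proof -
      have "(1 - P * q) * u * s = (1 - P * q) * (s' + P * y)"
        using us by (simp add: P_def mult.assoc)
      also have "\<dots> = s' + P * (y - s' * q) - P * P * q * y" by (simp add: algebra_simps)
      also have "y - s' * q = \<rho>" using y by simp
      finally show ?thesis by (simp add: P_def algebra_simps)
    qed
    moreover have "degree (s' + P * \<rho>) = d"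
    proof (cases "\<rho> = 0")
      case False
      have P: "P = [:\<pi> ^ Suc i:]" by (simp add: P_def poly_const_pow)
      have "degree (P * \<rho>) \<le> degree \<rho>" unfolding P by (simp add: degree_smult_le del: power_Suc)
      then have "degree (P * \<rho>) < d" using False \<rho> by auto
      then show ?thesis using s'(1) by (simp add: degree_add_eq_left)
    qed (use s' in simp)
    moreover have "pred (s' + P * \<rho>) = pred s"
      using s' by (simp add: poly.hom_add poly.hom_mult redP)
    ultimately show ?case by blast
  qed
  from this[of N] obtain u s' where "u dvd 1" "u * s = s'" "degree s' = d" "pred s' = pred s"
    by (auto simp: poly.nilpotent)
  then show ?thesis using lc[of s'] by (intro exI[of _ u]) (simp add: d_def)
qed

end

section \<open>Laurent series and noncatastrophic encoders\<close>

interpretation poly_to_fls: inj_comm_ring_hom "poly_to_fls :: 'a::comm_ring_1 poly \<Rightarrow> 'a fls"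
  by unfold_locales
    (auto simp: poly_to_fls_def fps_of_poly_add fps_of_poly_mult fls_times_fps_to_fls
      fps_of_poly_eq_iff)

lemma poly_to_fls_nth: "fls_nth (poly_to_fls f) i = (if i < 0 then 0 else coeff f (nat i))"
  by (simp add: poly_to_fls_def)

lemma poly_to_fls_X_power: "poly_to_fls ([:0, 1:] ^ m) = fls_X ^ m"
  by (simp add: poly_to_fls_def fps_of_poly_power fps_to_fls_power)

lemma poly_to_fls_unit:
  fixes f :: "'a::comm_ring_1 poly"
  assumes "coeff f 0 dvd 1"
  obtains g where "g * poly_to_fls f = 1"
proof -
  obtain y where "1 = coeff f 0 * y" using assms by (rule dvdE)
  then have "y * fps_nth (fps_of_poly f) 0 = 1" by (simp add: mult.commute)
  then have "fps_left_inverse (fps_of_poly f) y * fps_of_poly f = 1" by (rule fps_left_inverse)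
  then have "fps_to_fls (fps_left_inverse (fps_of_poly f) y) * poly_to_fls f = 1"
    unfolding poly_to_fls_def by (simp only: fls_times_fps_to_fls[symmetric] fps_one_to_fls)
  then show thesis by (rule that)
qed

text \<open>Finite weight means being a Laurent polynomial; this turns statements on weights into
  algebra.\<close>

lemma fls_wt_finite_iff:
  fixes f :: "'a::comm_ring_1 fls"
  shows "fls_wt f < \<infinity> \<longleftrightarrow> (\<exists>N g. fls_X ^ N * f = poly_to_fls g)"
proof -
  define S where "S = {i. fls_nth f i \<noteq> 0}"
  have "fls_wt f < \<infinity> \<longleftrightarrow> finite S" by (simp add: fls_wt_def S_def Let_def)
  also have "\<dots> \<longleftrightarrow> (\<exists>N g. fls_X ^ N * f = poly_to_fls g)"
  proof
    assume fin: "finite S"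
    obtain N :: nat where N: "\<And>i. i \<in> S \<Longrightarrow> \<bar>i\<bar> < int N"
    proof -
      obtain M where M: "\<And>i. i \<in> abs ` S \<Longrightarrow> i < M"
        using finite_nat_set_iff_bounded fin by (metis bdd_above_def bdd_above.unfold finite_imageI finite_has_maximal zle_add1_eq_le Max_ge less_add_one le_less_trans)
      show thesis by (rule that[of "nat M"]) (use M in fastforce)
    qed
    \<comment> \<open>The support lies strictly between \<open>- N\<close> and \<open>N\<close>, so
      the shift by \<open>N\<close> moves it to natural exponents below
      \<open>2 * N\<close>.\<close>
    define g where "g = (\<Sum>i<2 * N. monom (fls_nth f (int i - int N)) i)"
    have g: "coeff g i = (if i < 2 * N then fls_nth f (int i - int N) else 0)" for i
      by (simp add: g_def coeff_sum)
    have "fls_X ^ N * f = poly_to_fls g"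
    proof (rule fls_eqI)
      fix i
      show "fls_nth (fls_X ^ N * f) i = fls_nth (poly_to_fls g) i"
      proof (cases "fls_nth f (i - int N) = 0")
        case False
        then have "\<bar>i - int N\<bar> < int N" by (intro N) (simp add: S_def)
        then show ?thesis by (auto simp: fls_X_power_times_conv_shift poly_to_fls_nth g)
      qed (auto simp: fls_X_power_times_conv_shift poly_to_fls_nth g)
    qed
    then show "\<exists>N g. fls_X ^ N * f = poly_to_fls g" by blast
  next
    assume "\<exists>N g. fls_X ^ N * f = poly_to_fls g"
    then obtain N g where "fls_X ^ N * f = poly_to_fls g" by blast
    then have fg: "fls_nth f i = fls_nth (poly_to_fls g) (i + int N)" for i
      by (metis add_diff_cancel_right' fls_X_power_times_conv_shift(1) fls_shift_nth diff_conv_add_uminus)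
    have "S \<subseteq> {- int N..int (degree g)}"
    proof
      fix i assume "i \<in> S"
      then have "0 \<le> i + int N" "coeff g (nat (i + int N)) \<noteq> 0"
        by (auto simp: S_def fg poly_to_fls_nth split: if_splits)
      with le_degree show "i \<in> {- int N..int (degree g)}" by force
    qed
    then show "finite S" by (rule finite_subset) simp
  qed
  finally show ?thesis .
qed

lemma wt_finite_iff_entries: "wt v < \<infinity> \<longleftrightarrow> (\<forall>i<dim_vec v. fls_wt (v $ i) < \<infinity>)"
proof -
  have "(\<Sum>i<n. h i) < (\<infinity> :: enat) \<longleftrightarrow> (\<forall>i<n. h i < \<infinity>)" for h :: "nat \<Rightarrow> enat" and n
    by (induction n) (auto simp: less_Suc_eq plus_eq_infty_iff_enat less_top[symmetric] top_enat_def)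
  then show ?thesis by (simp add: wt_def)
qed

lemma common_X_power:
  fixes f :: "'i \<Rightarrow> 'a::comm_ring_1 fls"
  assumes "finite A" and "\<forall>a\<in>A. fls_wt (f a) < \<infinity>"
  shows "\<exists>N g. \<forall>a\<in>A. fls_X ^ N * f a = poly_to_fls (g a)"
proof -
  obtain N g where Ng: "\<And>a. a \<in> A \<Longrightarrow> fls_X ^ N a * f a = poly_to_fls (g a)"
    using assms(2) unfolding fls_wt_finite_iff by metis
  \<comment> \<open>The sum is a convenient bound for all exponents at once.\<close>
  define M where "M = sum N A"
  have "fls_X ^ M * f a = poly_to_fls ([:0, 1:] ^ (M - N a) * g a)" if a: "a \<in> A" for a
  proof -
    have "N a \<le> M" unfolding M_def by (rule member_le_sum) (use a assms(1) in auto)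
    then have "fls_X ^ M * f a = fls_X ^ (M - N a) * (fls_X ^ N a * f a)"
      by (simp flip: mult.assoc power_add)
    then show ?thesis by (simp only: Ng[OF a] poly_to_fls.hom_mult poly_to_fls_X_power)
  qed
  then show ?thesis by (intro exI ballI)
qed

lemma wt_finite_iff:
  fixes v :: "'a::comm_ring_1 fls vec"
  assumes v: "v \<in> carrier_vec n"
  shows "wt v < \<infinity> \<longleftrightarrow> (\<exists>N. \<exists>g\<in>carrier_vec n. fls_X ^ N \<cdot>\<^sub>v v = map_vec poly_to_fls g)"
proof
  assume "wt v < \<infinity>"
  then have "\<forall>i\<in>{..<n}. fls_wt (v $ i) < \<infinity>"
    using v unfolding wt_finite_iff_entries by auto
  from common_X_power[OF _ this] obtain N g where
    "\<And>i. i < n \<Longrightarrow> fls_X ^ N * v $ i = poly_to_fls (g i)" by auto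
  then have "fls_X ^ N \<cdot>\<^sub>v v = map_vec poly_to_fls (vec n g)"
    using v by (intro eq_vecI) auto
  then show "\<exists>N. \<exists>g\<in>carrier_vec n. fls_X ^ N \<cdot>\<^sub>v v = map_vec poly_to_fls g" by (metis vec_carrier)
next
  assume "\<exists>N. \<exists>g\<in>carrier_vec n. fls_X ^ N \<cdot>\<^sub>v v = map_vec poly_to_fls g"
  then obtain N g where g: "g \<in> carrier_vec n" and Ng: "fls_X ^ N \<cdot>\<^sub>v v = map_vec poly_to_fls g"
    by blast
  have "fls_X ^ N * v $ i = poly_to_fls (g $ i)" if "i < n" for i
    using arg_cong[OF Ng, of "\<lambda>w. w $ i"] v g that by simp
  then show "wt v < \<infinity>" using v unfolding wt_finite_iff_entries fls_wt_finite_iff by auto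
qed

lemma mult_mat_vec_smult:
  fixes A :: "'a::comm_ring_1 mat"
  assumes "A \<in> carrier_mat m k" and "v \<in> carrier_vec k"
  shows "A *\<^sub>v (c \<cdot>\<^sub>v v) = c \<cdot>\<^sub>v (A *\<^sub>v v)"
  by (rule eq_vecI) (use assms in auto)

lemma laurent_mat_carrier [simp]: "laurent_mat G \<in> carrier_mat k n \<longleftrightarrow> G \<in> carrier_mat k n"
  by (auto simp: laurent_mat_def)

lemma laurent_mat_mult:
  "A \<in> carrier_mat m k \<Longrightarrow> B \<in> carrier_mat k n \<Longrightarrow>
    laurent_mat (A * B) = laurent_mat A * laurent_mat B"
  unfolding laurent_mat_def by (rule poly_to_fls.mat_hom_mult)

lemma laurent_mat_inj: "laurent_mat A = laurent_mat B \<longleftrightarrow> A = B"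
  unfolding laurent_mat_def by (auto dest: poly_to_fls.mat_hom_inj)

lemma laurent_mat_transpose: "transpose_mat (laurent_mat A) = laurent_mat (transpose_mat A)"
  by (rule eq_matI) (auto simp: laurent_mat_def)

lemma encode_carrier: "G \<in> carrier_mat k n \<Longrightarrow> encode G u \<in> carrier_vec n"
  by (rule carrier_vecI) (simp add: encode_def laurent_mat_def)

lemma encode_poly:
  assumes "G \<in> carrier_mat k n" and "u \<in> carrier_vec k"
  shows "encode G (map_vec poly_to_fls u) = map_vec poly_to_fls (transpose_mat G *\<^sub>v u)"
  using poly_to_fls.mult_mat_vec_hom[of "transpose_mat G" n k u] assms
  by (simp add: encode_def laurent_mat_transpose) (simp add: laurent_mat_def)

lemma encode_smult:
  assumes "G \<in> carrier_mat k n" and "u \<in> carrier_vec k"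
  shows "encode G (c \<cdot>\<^sub>v u) = c \<cdot>\<^sub>v encode G u"
  unfolding encode_def by (rule mult_mat_vec_smult[of _ n k]) (use assms in auto)

text \<open>This half of noncatastrophicity holds for every polynomial matrix: the power of the
  indeterminate that clears \<open>u\<close> also clears its image.\<close>

lemma wt_encode_finite:
  assumes G: "G \<in> carrier_mat k n" and u: "u \<in> carrier_vec k" and fin: "wt u < \<infinity>"
  shows "wt (encode G u) < \<infinity>"
proof -
  obtain N g where g: "g \<in> carrier_vec k" and Ng: "fls_X ^ N \<cdot>\<^sub>v u = map_vec poly_to_fls g"
    using fin wt_finite_iff[OF u] by blast
  have "fls_X ^ N \<cdot>\<^sub>v encode G u = map_vec poly_to_fls (transpose_mat G *\<^sub>v g)"
    using encode_smult[OF G u, of "fls_X ^ N"] Ng encode_poly[OF G g] by simp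
  moreover have "transpose_mat G *\<^sub>v g \<in> carrier_vec n" using G g by simp
  ultimately show ?thesis unfolding wt_finite_iff[OF encode_carrier[OF G]] by blast
qed

text \<open>Multiplying the codeword by \<open>K\<close> returns \<open>fls_X ^ a\<close> times
  \<open>u\<close>, so a codeword of finite weight comes from an input of finite weight.\<close>

lemma noncatastrophic_if_right_factor:
  assumes G: "G \<in> carrier_mat k n" and K: "K \<in> carrier_mat n k"
    and GK: "G * K = [:0, 1:] ^ a \<cdot>\<^sub>m 1\<^sub>m k"
  shows "noncatastrophic_encoder G"
proof -
  have "wt u < \<infinity>" if u: "u \<in> carrier_vec k" and fin: "wt (encode G u) < \<infinity>" for u
  proof -
    obtain N g where g: "g \<in> carrier_vec n"
      and Ng: "fls_X ^ N \<cdot>\<^sub>v encode G u = map_vec poly_to_fls g"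
      using fin wt_finite_iff[OF encode_carrier[OF G]] by blast
    have KG: "laurent_mat (transpose_mat K) * laurent_mat (transpose_mat G) = fls_X ^ a \<cdot>\<^sub>m 1\<^sub>m k"
    proof -
      have "laurent_mat (transpose_mat K) * laurent_mat (transpose_mat G) =
        laurent_mat (transpose_mat (G * K))"
        using G K by (simp add: transpose_mult[OF G K] laurent_mat_mult[of _ k n])
      also have "\<dots> = fls_X ^ a \<cdot>\<^sub>m 1\<^sub>m k" unfolding GK
        by (rule eq_matI) (auto simp: laurent_mat_def poly_to_fls.hom_mult poly_to_fls_X_power)
      finally show ?thesis .
    qed
    have "map_vec poly_to_fls (transpose_mat K *\<^sub>v g) = laurent_mat (transpose_mat K) *\<^sub>v map_vec poly_to_fls g"
      using poly_to_fls.mult_mat_vec_hom[of "transpose_mat K" k n g] K g by (simp add: laurent_mat_def)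
    also have "\<dots> = laurent_mat (transpose_mat K) *\<^sub>v (fls_X ^ N \<cdot>\<^sub>v (laurent_mat (transpose_mat G) *\<^sub>v u))"
      by (simp add: encode_def laurent_mat_transpose flip: Ng)
    also have "\<dots> = fls_X ^ N \<cdot>\<^sub>v (laurent_mat (transpose_mat K) *\<^sub>v (laurent_mat (transpose_mat G) *\<^sub>v u))"
      by (rule mult_mat_vec_smult[of _ k n]) (use G K u in auto)
    also have "laurent_mat (transpose_mat K) *\<^sub>v (laurent_mat (transpose_mat G) *\<^sub>v u) =
      laurent_mat (transpose_mat K) * laurent_mat (transpose_mat G) *\<^sub>v u"
      using G K u by (intro assoc_mult_mat_vec[symmetric, of _ k n _ k]) auto
    also have "\<dots> = fls_X ^ a \<cdot>\<^sub>v u" unfolding KG using u by (intro eq_vecI) auto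
    finally have "fls_X ^ (N + a) \<cdot>\<^sub>v u = map_vec poly_to_fls (transpose_mat K *\<^sub>v g)"
      using u by (auto simp: power_add smult_smult_assoc)
    then show ?thesis using wt_finite_iff[OF u] K g
      by (metis mult_mat_vec_carrier transpose_carrier_mat)
  qed
  then show ?thesis using G wt_encode_finite[OF G] by (auto simp: noncatastrophic_encoder_def)
qed

context chain_reduction
begin

abbreviation Delta :: "'a poly mat \<Rightarrow> 'b poly" where
  "Delta G \<equiv> Gcd (full_minors (map_mat pred G) - {0})"

lemma e_nonzero: "e \<noteq> 0"
  using socle[of 1] by auto

text \<open>If all reduced minors vanished, the nonzero constant \<open>e\<close> would annihilate
  every full minor of \<open>G\<close>, and McCoy's theorem would give a nonzero input with zero
  output.\<close>

lemma nonzero_reduced_minor: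
  assumes "full_row_rank G"
  obtains m where "m \<in> full_minors (map_mat pred G)" "m \<noteq> 0"
proof (rule ccontr)
  assume "\<not> thesis"
  with that have zero: "\<And>m. m \<in> full_minors (map_mat pred G) \<Longrightarrow> m = 0" by blast
  let ?k = "dim_row G" and ?n = "dim_col G"
  have A: "laurent_mat G \<in> carrier_mat ?k ?n" by simp
  have "poly_to_fls [:e:] * m \<in> {0}" if m: "m \<in> full_minors (laurent_mat G)" for m
  proof -
    obtain m' where m': "m' \<in> full_minors G" "m = poly_to_fls m'"
      using m unfolding laurent_mat_def poly_to_fls.full_minors_hom by blast
    then have "pred m' = 0" using zero poly.full_minors_hom by blast
    then have "[:e:] * m' = 0" using poly_socle by blast
    then have "poly_to_fls ([:e:] * m') = 0" by simp
    then show ?thesis using m' by (simp only: poly_to_fls.hom_mult singleton_iff)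
  qed
  moreover have "poly_to_fls [:e:] \<notin> {0}" using e_nonzero by simp
  ultimately obtain u where u: "u \<in> carrier_vec ?k" "\<exists>i<?k. u $ i \<notin> {0}"
    "\<And>j. j < ?n \<Longrightarrow> (transpose_mat (laurent_mat G) *\<^sub>v u) $ j \<in> {0}"
    using mccoy_ideal[OF A, of "{0}" "poly_to_fls [:e:]"] by auto
  have "encode G u = 0\<^sub>v ?n"
    by (rule eq_vecI) (use u(3) in \<open>auto simp: encode_def laurent_mat_def\<close>)
  then have "u = 0\<^sub>v ?k" using assms u(1) by (simp add: full_row_rank_def)
  then show False using u(2) by auto
qed

lemma Delta_nonzero: "full_row_rank G \<Longrightarrow> Delta G \<noteq> 0"
  by (rule nonzero_reduced_minor) (auto simp: Gcd_0_iff)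

lemma noncatastrophic_if_Delta:
  assumes "Delta G = [:0, 1:] ^ m"
  shows "noncatastrophic_encoder G"
proof -
  have G: "G \<in> carrier_mat (dim_row G) (dim_col G)" by simp
  then have "map_mat pred G \<in> carrier_mat (dim_row G) (dim_col G)" by simp
  from Gcd_minors_right_factor[OF this] obtain K where K: "K \<in> carrier_mat (dim_col G) (dim_row G)"
    "map_mat pred G * K = [:0, 1:] ^ m \<cdot>\<^sub>m 1\<^sub>m (dim_row G)" using assms by auto
  have "pred ([:0, 1:] ^ m) = [:0, 1:] ^ m" by (simp add: poly.hom_power)
  with poly.right_factor_lift[OF G K(1), of "[:0, 1:] ^ m"] K obtain a K where
    "K \<in> carrier_mat (dim_col G) (dim_row G)" "G * K = ([:0, 1:] ^ m) ^ a \<cdot>\<^sub>m 1\<^sub>m (dim_row G)"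
    by auto
  then show ?thesis using noncatastrophic_if_right_factor[OF G, of K "m * a"] by (simp add: power_mult)
qed

text \<open>
  If a nonconstant \<open>s\<close> with \<open>s(0) \<noteq> 0\<close> divides all reduced minors, then some \<open>u \<noteq> 0\<close> modulo \<open>s\<close>
  satisfies \<open>u G = 0\<close> modulo \<open>(s, \<pi>)\<close>, and the input \<open>e u / s\<close> has infinite weight although its
  image \<open>e u G / s\<close> is polynomial.
\<close>

lemma Delta_if_noncatastrophic:
  assumes rank: "full_row_rank G" and noncat: "noncatastrophic_encoder G"
  shows "\<exists>m. Delta G = [:0, 1:] ^ m"
proof -
  let ?k = "dim_row G" and ?n = "dim_col G"
  have G: "G \<in> carrier_mat ?k ?n" by simp
  obtain m sb where \<Delta>: "Delta G = [:0, 1:] ^ m * sb" and sb: "poly sb 0 \<noteq> 0"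
    using X_power_decomposition[OF Delta_nonzero[OF rank]] .
  have "is_unit sb"
  proof (rule ccontr)
    assume nonunit: "\<not> is_unit sb"
    \<comment> \<open>McCoy's theorem is applied modulo \<open>sb\<close> with multiplier 1, which
      is not a multiple of \<open>sb\<close> because \<open>sb\<close> is not a unit.\<close>
    have "1 * x \<in> {f. sb dvd f}" if "x \<in> full_minors (map_mat pred G)" for x
    proof (cases "x = 0")
      case False
      then have "Delta G dvd x" using that by (intro Gcd_dvd) auto
      then show ?thesis using \<Delta> by (auto dest: dvd_mult_right)
    qed auto
    moreover have "map_mat pred G \<in> carrier_mat ?k ?n" by simp
    ultimately obtain ub where ub: "ub \<in> carrier_vec ?k" "\<exists>i<?k. ub $ i \<notin> {f. sb dvd f}"
      "\<And>j. j < ?n \<Longrightarrow> (transpose_mat (map_mat pred G) *\<^sub>v ub) $ j \<in> {f. sb dvd f}"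
      using mccoy_ideal[of "map_mat pred G" ?k ?n "{f. sb dvd f}" 1] nonunit by auto
    obtain i where i: "i < ?k" "\<not> sb dvd ub $ i" using ub(2) by blast
    have "\<forall>j<?n. \<exists>w. (transpose_mat (map_mat pred G) *\<^sub>v ub) $ j = sb * w"
      using ub(3) by (auto simp: dvd_def)
    then obtain w where w: "\<And>j. j < ?n \<Longrightarrow> (transpose_mat (map_mat pred G) *\<^sub>v ub) $ j = sb * w j"
      by metis
    obtain s where s: "pred s = sb" using poly.surj_red by (metis surjD)
    obtain u where u: "u \<in> carrier_vec ?k" "map_vec pred u = ub" using poly.lift_vec[OF ub(1)] .
    obtain v where v: "v \<in> carrier_vec ?n" "map_vec pred v = vec ?n w"
      using poly.lift_vec[OF vec_carrier] .
    \<comment> \<open>Both sides agree modulo \<open>\<pi>\<close> before multiplication by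
      \<open>e\<close>, and \<open>e\<close> annihilates the difference.\<close>
    have eGu: "[:e:] * (transpose_mat G *\<^sub>v u) $ j = [:e:] * (s * v $ j)" if j: "j < ?n" for j
    proof -
      have "pred ((transpose_mat G *\<^sub>v u) $ j) = map_vec pred (transpose_mat G *\<^sub>v u) $ j"
        using j by simp
      also have "map_vec pred (transpose_mat G *\<^sub>v u) = transpose_mat (map_mat pred G) *\<^sub>v ub"
        using poly.mult_mat_vec_hom[of "transpose_mat G" ?n ?k u] u by (simp add: map_mat_transpose)
      also have "\<dots> $ j = pred s * pred (v $ j)"
        using w[OF j] arg_cong[OF v(2), of "\<lambda>x. x $ j"] v(1) j s by simp
      finally have "pred ((transpose_mat G *\<^sub>v u) $ j - s * v $ j) = 0"
        by (simp only: poly.hom_minus poly.hom_mult) simp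
      then have "[:e:] * ((transpose_mat G *\<^sub>v u) $ j - s * v $ j) = 0" using poly_socle by blast
      then show ?thesis by (simp only: right_diff_distrib right_minus_eq)
    qed
    have "red (coeff s 0) \<noteq> 0" using sb s by (auto simp: poly_0_coeff_0 coeff_map_poly)
    then obtain \<sigma> where \<sigma>: "\<sigma> * poly_to_fls s = 1"
      using poly_to_fls_unit[of s] unit_iff by blast
    define x where "x = (\<sigma> * poly_to_fls [:e:]) \<cdot>\<^sub>v map_vec poly_to_fls u"
    have x: "x \<in> carrier_vec ?k" using u by (simp add: x_def)
    have "encode G x = map_vec poly_to_fls ([:e:] \<cdot>\<^sub>v v)"
    proof (rule eq_vecI)
      fix j assume "j < dim_vec (map_vec poly_to_fls ([:e:] \<cdot>\<^sub>v v))"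
      then have j: "j < ?n" using v by simp
      have "encode G x = (\<sigma> * poly_to_fls [:e:]) \<cdot>\<^sub>v map_vec poly_to_fls (transpose_mat G *\<^sub>v u)"
        unfolding x_def using u encode_smult[OF G] encode_poly[OF G] by simp
      then have "encode G x $ j = \<sigma> * poly_to_fls [:e:] * poly_to_fls ((transpose_mat G *\<^sub>v u) $ j)"
        using j by simp
      also have "\<dots> = \<sigma> * poly_to_fls ([:e:] * (transpose_mat G *\<^sub>v u) $ j)"
        by (simp only: poly_to_fls.hom_mult mult.assoc)
      also have "\<dots> = (\<sigma> * poly_to_fls s) * poly_to_fls ([:e:] * v $ j)"
        unfolding eGu[OF j] by (simp only: poly_to_fls.hom_mult ac_simps)
      finally show "encode G x $ j = map_vec poly_to_fls ([:e:] \<cdot>\<^sub>v v) $ j"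
        using \<sigma> v(1) j by simp
    qed (use v encode_carrier[OF G, of x] in auto)
    then have "wt (encode G x) < \<infinity>"
      using wt_finite_iff[OF encode_carrier[OF G]] v(1) by (metis one_smult_vec power_0 smult_carrier_vec)
    then have "wt x < \<infinity>" using noncat x by (auto simp: noncatastrophic_encoder_def)
    then obtain N g where g: "g \<in> carrier_vec ?k" and Ng: "fls_X ^ N \<cdot>\<^sub>v x = map_vec poly_to_fls g"
      using wt_finite_iff[OF x] by blast
    define X where "X = ([:0, 1:] ^ N :: 'a poly)"
    have "poly_to_fls (X * ([:e:] * u $ i)) = poly_to_fls (s * g $ i)"
    proof -
      have "poly_to_fls X * (\<sigma> * poly_to_fls [:e:] * poly_to_fls (u $ i)) = poly_to_fls (g $ i)"
        using arg_cong[OF Ng, of "\<lambda>w. w $ i"] i u g by (simp add: x_def X_def poly_to_fls_X_power)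
      moreover have "poly_to_fls s * (poly_to_fls X * (\<sigma> * poly_to_fls [:e:] * poly_to_fls (u $ i))) =
        (\<sigma> * poly_to_fls s) * (poly_to_fls X * (poly_to_fls [:e:] * poly_to_fls (u $ i)))"
        by (simp only: ac_simps)
      ultimately show ?thesis using \<sigma> by (simp only: poly_to_fls.hom_mult mult_1)
    qed
    then have eq: "X * ([:e:] * u $ i) = s * g $ i" by simp
    \<comment> \<open>Multiplication of \<open>eq\<close> by \<open>\<pi>\<close> kills its left
      side. As \<open>s\<close> is invertible among Laurent series, \<open>g $ i\<close> is
      annihilated by \<open>\<pi>\<close> and hence a multiple of \<open>e\<close>.\<close>
    have "[:\<pi>:] * [:e:] = 0" using socle[of \<pi>] by (simp add: mult.commute)
    moreover have "[:\<pi>:] * (X * ([:e:] * u $ i)) = [:\<pi>:] * [:e:] * (X * u $ i)"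
      by (simp only: ac_simps)
    ultimately have "[:\<pi>:] * (X * ([:e:] * u $ i)) = 0" by (simp only: mult_zero_left)
    then have "s * ([:\<pi>:] * g $ i) = 0" unfolding eq by (simp only: mult.left_commute)
    then have "\<sigma> * poly_to_fls (s * ([:\<pi>:] * g $ i)) = 0" by simp
    then have "(\<sigma> * poly_to_fls s) * poly_to_fls ([:\<pi>:] * g $ i) = 0"
      by (simp only: poly_to_fls.hom_mult mult.assoc)
    then have "[:\<pi>:] * g $ i = 0" using \<sigma> by simp
    then obtain h where h: "g $ i = [:e:] * h" using poly_annihilator by (metis dvdE)
    \<comment> \<open>Dropping \<open>e\<close> leaves a congruence modulo \<open>\<pi>\<close>, by
      which \<open>sb\<close> divides a power of the indeterminate times \<open>ub $ i\<close>.
      Coprimality then contradicts the choice of \<open>i\<close>.\<close>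
    have "[:e:] * (X * u $ i - s * h) = 0"
      using eq h by (simp only: right_diff_distrib mult.left_commute right_minus_eq)
    then have "pred (X * u $ i - s * h) = 0" using poly_socle by blast
    then have "pred X * ub $ i = sb * pred h"
      using s arg_cong[OF u(2), of "\<lambda>x. x $ i"] u(1) i(1)
      by (simp add: poly.hom_minus poly.hom_mult)
    moreover have "pred X = [:0, 1:] ^ N" by (simp add: X_def poly.hom_power)
    ultimately have "sb dvd [:0, 1:] ^ N * ub $ i" by simp
    then show False using coprime_X_power[OF sb, of N] i(2) coprime_dvd_mult_right_iff coprime_commute by blast
  qed
  then have "Delta G dvd [:0, 1:] ^ m" using \<Delta> by simp
  then show ?thesis by (rule dvd_X_power) simp
qed

end

section \<open>Change of encoder\<close>

lemma encode_mult:
  assumes M: "M \<in> carrier_mat m k" and G: "G \<in> carrier_mat k n" and u: "u \<in> carrier_vec m"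
    and H: "laurent_mat H = M * laurent_mat G"
  shows "encode H u = encode G (transpose_mat M *\<^sub>v u)"
proof -
  have "transpose_mat (M * laurent_mat G) = transpose_mat (laurent_mat G) * transpose_mat M"
    by (rule transpose_mult[OF M]) (use G in simp)
  then show ?thesis unfolding encode_def H
    using assoc_mult_mat_vec[of "transpose_mat (laurent_mat G)" n k "transpose_mat M" m u] M G u
    by simp
qed

lemma encode_zero: "G \<in> carrier_mat k n \<Longrightarrow> encode G (0\<^sub>v k) = 0\<^sub>v n"
  by (rule eq_vecI) (auto simp: encode_def laurent_mat_def)

lemma encoder_dim_col:
  assumes "encoder C G" and "encoder C G'"
  shows "dim_col G = dim_col G'"
proof -
  have "encode G (0\<^sub>v (dim_row G)) \<in> encode G' ` carrier_vec (dim_row G')"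
    using assms unfolding encoder_def by auto
  then show ?thesis by (auto simp: encode_def laurent_mat_def dest: arg_cong[of _ _ dim_vec])
qed

text \<open>The rows of \<open>G'\<close> are codewords, namely images of unit vectors, so
  \<open>G\<close> encodes them from some inputs; these inputs are the rows of \<open>T\<close>. The
  last conclusion lets noncatastrophicity of \<open>G\<close> act on each row.\<close>

lemma encoder_transition:
  assumes C: "encoder C G" "encoder C G'"
  obtains T where "T \<in> carrier_mat (dim_row G') (dim_row G)"
    "laurent_mat G' = T * laurent_mat G"
    "\<And>i. i < dim_row G' \<Longrightarrow> encode G (row T i) = row (laurent_mat G') i"
proof -
  let ?k = "dim_row G" and ?k' = "dim_row G'" and ?n = "dim_col G"
  have n: "dim_col G' = ?n" using encoder_dim_col[OF C] by simp
  have "\<exists>u\<in>carrier_vec ?k. encode G u = row (laurent_mat G') i" if i: "i < ?k'" for i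
  proof -
    have "encode G' (unit_vec ?k' i) = row (laurent_mat G') i"
      by (rule eq_vecI) (use i in \<open>auto simp: encode_def laurent_mat_def\<close>)
    then have "row (laurent_mat G') i \<in> C"
      using C(2) unfolding encoder_def by (metis imageI unit_vec_carrier)
    then show ?thesis using C(1) unfolding encoder_def by auto
  qed
  then obtain u where u: "\<And>i. i < ?k' \<Longrightarrow> u i \<in> carrier_vec ?k"
    "\<And>i. i < ?k' \<Longrightarrow> encode G (u i) = row (laurent_mat G') i" by metis
  define T where "T = mat ?k' ?k (\<lambda>(i, j). u i $ j)"
  have T: "T \<in> carrier_mat ?k' ?k" by (simp add: T_def)
  have row: "row T i = u i" if "i < ?k'" for i
    using u(1)[OF that] that by (intro eq_vecI) (auto simp: T_def)
  have "laurent_mat G' = T * laurent_mat G"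
  proof (rule eq_matI)
    fix i j assume "i < dim_row (T * laurent_mat G)" "j < dim_col (T * laurent_mat G)"
    then have ij: "i < ?k'" "j < ?n" by (auto simp: T_def laurent_mat_def)
    have "laurent_mat G' $$ (i, j) = encode G (u i) $ j"
      using u(2)[OF ij(1)] ij n by (simp add: laurent_mat_def)
    also have "\<dots> = col (laurent_mat G) j \<bullet> u i"
      using ij by (simp add: encode_def laurent_mat_def)
    also have "\<dots> = row T i \<bullet> col (laurent_mat G) j"
      unfolding row[OF ij(1)]
      by (rule comm_scalar_prod[OF _ u(1)[OF ij(1)]])
        (rule carrier_vecI, simp add: laurent_mat_def)
    finally show "laurent_mat G' $$ (i, j) = (T * laurent_mat G) $$ (i, j)"
      using ij by (simp add: T_def laurent_mat_def)
  qed (auto simp: T_def laurent_mat_def n)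
  then show thesis using that T row u(2) by simp
qed

text \<open>A transition matrix with more rows than columns has no full minors, so McCoy's theorem
  gives a nonzero vector that it kills, against the full row rank of \<open>G'\<close>.\<close>

lemma encoder_dim_row_le:
  assumes C: "encoder C G" "encoder C G'"
  shows "dim_row G' \<le> dim_row G"
proof (rule ccontr)
  assume less: "\<not> dim_row G' \<le> dim_row G"
  let ?k = "dim_row G" and ?k' = "dim_row G'" and ?n = "dim_col G"
  have n: "dim_col G' = ?n" using encoder_dim_col[OF C] by simp
  obtain T where T: "T \<in> carrier_mat ?k' ?k" and G': "laurent_mat G' = T * laurent_mat G"
    using encoder_transition[OF C] .
  have "card J \<noteq> ?k'" if "J \<subseteq> {..<?k}" for J
    using card_mono[OF _ that] less by simp
  then have "{J. J \<subseteq> {..<?k} \<and> card J = ?k'} = {}" by blast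
  then have "full_minors T = {}"
    unfolding full_minors_eq carrier_matD[OF T] by (simp only: image_empty)
  then obtain u where u: "u \<in> carrier_vec ?k'" "\<exists>i<?k'. u $ i \<notin> {0}"
    "\<And>j. j < ?k \<Longrightarrow> (transpose_mat T *\<^sub>v u) $ j \<in> {0}"
    using mccoy_ideal[OF T, of "{0}" 1] by auto
  have "transpose_mat T *\<^sub>v u = 0\<^sub>v ?k"
    by (rule eq_vecI) (use u(3) T in auto)
  then have "encode G' u = 0\<^sub>v ?n"
    using encode_mult[OF T _ u(1) G', of ?n] encode_zero[of G ?k ?n] by auto
  then have "u = 0\<^sub>v ?k'" using C(2) u(1) n by (auto simp: encoder_def full_row_rank_def)
  then show False using u(2) by auto
qed

text \<open>The competitors in the definition of a reduced internal degree encoder encode the same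
  code: the transposes of \<open>M\<close> and its inverse are mutually inverse bijections on
  inputs.\<close>

lemma encoder_nonsingular_mult:
  assumes C: "encoder C G" and M: "nonsingular_ratfun_mat (dim_row G) M"
    and H: "laurent_mat H = M * laurent_mat G"
  shows "encoder C H"
proof -
  let ?k = "dim_row G" and ?n = "dim_col G"
  have G: "G \<in> carrier_mat ?k ?n" by simp
  obtain N where M: "M \<in> carrier_mat ?k ?k" and N: "N \<in> carrier_mat ?k ?k"
    and MN: "M * N = 1\<^sub>m ?k" "N * M = 1\<^sub>m ?k"
    using M unfolding nonsingular_ratfun_mat_def by blast
  have dims: "dim_row H = ?k" "dim_col H = ?n"
    using arg_cong[OF H, of dim_row] arg_cong[OF H, of dim_col] M by (auto simp: laurent_mat_def)
  have TMN: "transpose_mat N * transpose_mat M = 1\<^sub>m ?k" "transpose_mat M * transpose_mat N = 1\<^sub>m ?k"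
    by (simp_all only: transpose_mult[OF M N, symmetric] transpose_mult[OF N M, symmetric] MN
        transpose_one)
  have inv: "transpose_mat N *\<^sub>v (transpose_mat M *\<^sub>v u) = u"
    "transpose_mat M *\<^sub>v (transpose_mat N *\<^sub>v u) = u" if "u \<in> carrier_vec ?k" for u
    using that M N TMN assoc_mult_mat_vec[of "transpose_mat N" ?k ?k "transpose_mat M" ?k u]
      assoc_mult_mat_vec[of "transpose_mat M" ?k ?k "transpose_mat N" ?k u] by simp_all
  have enc: "encode H u = encode G (transpose_mat M *\<^sub>v u)" if "u \<in> carrier_vec ?k" for u
    by (rule encode_mult[OF M G that H])
  have Mu: "transpose_mat M *\<^sub>v u \<in> carrier_vec ?k" "transpose_mat N *\<^sub>v u \<in> carrier_vec ?k"
    if "u \<in> carrier_vec ?k" for u using that M N by auto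
  have "full_row_rank H"
    unfolding full_row_rank_def dims
  proof (intro ballI impI)
    fix u assume u: "u \<in> carrier_vec ?k" "encode H u = 0\<^sub>v ?n"
    then have "transpose_mat M *\<^sub>v u = 0\<^sub>v ?k"
      using C Mu enc by (auto simp: encoder_def full_row_rank_def)
    then have "u = transpose_mat N *\<^sub>v 0\<^sub>v ?k" using inv(1)[OF u(1)] by simp
    also have "\<dots> = 0\<^sub>v ?k" using N by (intro eq_vecI) auto
    finally show "u = 0\<^sub>v ?k" .
  qed
  moreover have "encode H ` carrier_vec ?k = encode G ` carrier_vec ?k"
  proof (intro equalityI image_subsetI)
    fix u :: "'a fls vec" assume u: "u \<in> carrier_vec ?k"
    show "encode H u \<in> encode G ` carrier_vec ?k" using enc[OF u] Mu(1)[OF u] by simp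
    show "encode G u \<in> encode H ` carrier_vec ?k"
      using enc[OF Mu(2)[OF u]] inv(2)[OF u] Mu(2)[OF u] by (metis image_eqI)
  qed
  ultimately show ?thesis using C by (simp add: encoder_def dims)
qed

text \<open>A minimum over all encoders of \<open>C\<close> exists, and it is minimal among the
  multiples \<open>M G\<close> because these are encoders of \<open>C\<close> as well.\<close>

lemma reduced_internal_degree_encoder_exists:
  assumes "encoder C G"
  shows "\<exists>G. reduced_internal_degree_encoder C G"
proof -
  define G' where "G' = arg_min internal_degree (encoder C)"
  have "encoder C G'" and "\<And>H. encoder C H \<Longrightarrow> internal_degree G' \<le> internal_degree H"
    unfolding G'_def using arg_min_natI[of "encoder C", OF assms] arg_min_nat_le[of "encoder C"]
    by blast+
  then show ?thesis unfolding reduced_internal_degree_encoder_def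
    using encoder_nonsingular_mult by blast
qed

text \<open>A factor with unit leading coefficient adds its degree to every nonzero polynomial, even
  over a ring with zero divisors.\<close>

lemma internal_degree_less:
  fixes G H :: "'a::comm_ring_1 poly mat"
  assumes minors: "full_minors G = (*) t ` full_minors H"
    and t: "lead_coeff t dvd 1" "degree t > 0" and nz: "m \<in> full_minors G" "m \<noteq> 0"
  shows "internal_degree H < internal_degree G"
proof -
  have deg: "degree (t * w) = degree t + degree w" if "w \<noteq> 0" for w
  proof (rule antisym[OF degree_mult_le le_degree])
    obtain y where y: "1 = lead_coeff t * y" using t(1) by (rule dvdE)
    have "lead_coeff w = lead_coeff t * lead_coeff w * y"
      using y by (simp add: ac_simps flip: mult.assoc)
    then show "coeff (t * w) (degree t + degree w) \<noteq> 0"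
      using that unfolding coeff_mult_degree_sum by auto
  qed
  have finG: "finite (degree ` full_minors G)" by (simp add: finite_full_minors)
  obtain w0 where w0: "w0 \<in> full_minors H" "m = t * w0" using nz(1) minors by auto
  have "Max (degree ` full_minors H) \<in> degree ` full_minors H"
    using w0 by (intro Max_in) (auto simp: finite_full_minors)
  then obtain w where w: "w \<in> full_minors H" and max: "internal_degree H = degree w"
    by (auto simp: internal_degree_def)
  have "\<exists>x\<in>full_minors G. degree w < degree x"
  proof (cases "w = 0")
    \<comment> \<open>If the maximum is attained at 0, then it is the degree 0, and the nonzero
      minor \<open>m = t * w0\<close> already exceeds it.\<close>
    case True
    have "w0 \<noteq> 0" using w0 nz by auto
    then show ?thesis using True deg[of w0] t(2) w0 nz(1) by (intro bexI[of _ m]) auto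
  next
    case False
    then show ?thesis using deg[of w] t(2) w minors by (intro bexI[of _ "t * w"]) auto
  qed
  then obtain x where "x \<in> full_minors G" "degree w < degree x" by blast
  moreover from this have "degree x \<le> internal_degree G"
    unfolding internal_degree_def using finG by (intro Max_ge) auto
  ultimately show ?thesis using max by simp
qed

lemma ratfuns_over_unit:
  assumes "coeff b 0 dvd 1" and "f * poly_to_fls b = poly_to_fls a"
  shows "f \<in> ratfuns"
proof -
  have nz: "coeff b 0 \<noteq> 0" using assms(1) by auto
  then have "(LEAST i. coeff b i \<noteq> 0) = 0" by (intro Least_eq_0)
  then show ?thesis unfolding ratfuns_def using assms nz by (intro CollectI exI[of _ a] exI[of _ b]) auto
qed

text \<open>A unit constant coefficient of \<open>s\<close> forces the constant coefficient of
  \<open>x\<close> to vanish, so the indeterminate can be cancelled one factor at a time.\<close>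

lemma X_power_dvd_cancel_unit:
  fixes s :: "'a::comm_ring_1 poly"
  assumes s: "coeff s 0 dvd 1" and "s * x = [:0, 1:] ^ N * y"
  shows "[:0, 1:] ^ N dvd x"
  using assms(2)
proof (induction N arbitrary: x)
  case (Suc N)
  obtain y' where y': "1 = coeff s 0 * y'" using s by (rule dvdE)
  have "coeff s 0 * coeff x 0 = coeff ([:0, 1:] ^ Suc N * y) 0"
    using Suc.prems by (metis coeff_mult_0)
  also have "\<dots> = 0" by (simp add: coeff_mult_0)
  finally have "y' * (coeff s 0 * coeff x 0) = 0" by simp
  then have "coeff s 0 * y' * coeff x 0 = 0" by (simp only: ac_simps)
  then have x0: "coeff x 0 = 0" by (simp flip: y')
  obtain x' where x': "x = pCons 0 x'" using x0 by (cases x) auto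
  have "pCons 0 (s * x') = pCons 0 ([:0, 1:] ^ N * y)"
    using Suc.prems by (simp add: x' mult.assoc)
  then have "[:0, 1:] ^ N dvd x'" using Suc.IH by simp
  then show ?case unfolding x' by (auto simp: dvd_def mult.assoc)
qed simp

lemma X_power_mult_cancel:
  fixes f :: "'a::comm_ring_1 poly"
  shows "[:0, 1:] ^ N * f = [:0, 1:] ^ N * g \<longleftrightarrow> f = g"
  by (induction N) (auto simp: mult.assoc)

lemma Gcd_minus_zero: "Gcd (A - {0}) = Gcd (A :: 'a::semiring_Gcd set)"
proof -
  have "Gcd (insert 0 A) = Gcd (insert 0 (A - {0}))" by simp
  then show ?thesis by (simp only: Gcd_insert gcd_0_left normalize_Gcd)
qed

lemma finite_weight_mat:
  assumes T: "T \<in> carrier_mat m k" and fin: "\<And>i. i < m \<Longrightarrow> wt (row T i) < \<infinity>"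
  obtains N T' where "T' \<in> carrier_mat m k" "fls_X ^ N \<cdot>\<^sub>m T = laurent_mat T'"
proof -
  have "\<forall>ij\<in>{..<m} \<times> {..<k}. fls_wt (T $$ ij) < \<infinity>"
    using fin T unfolding wt_finite_iff_entries by auto
  from common_X_power[OF _ this] obtain N g where
    g: "\<And>ij. ij \<in> {..<m} \<times> {..<k} \<Longrightarrow> fls_X ^ N * T $$ ij = poly_to_fls (g ij)" by auto
  have "fls_X ^ N \<cdot>\<^sub>m T = laurent_mat (mat m k g)"
    by (rule eq_matI) (use T g in \<open>auto simp: laurent_mat_def\<close>)
  then show thesis using that[of "mat m k g" N] by simp
qed

context chain_reduction
begin

text \<open>
  A left factor \<open>S\<close> of \<open>G\<close> whose determinant is nonconstant modulo \<open>\<pi>\<close> can be cancelled, which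
  lowers the internal degree. The unit \<open>u\<close> of \<open>weierstrass_preparation\<close> is moved into the first row
  of the quotient, since the degree of \<open>det S\<close> itself can drop in products.
\<close>

lemma reduced_encoder_left_factor:
  assumes red: "reduced_internal_degree_encoder C G"
    and S: "S \<in> carrier_mat (dim_row G) (dim_row G)"
    and G2: "G2 \<in> carrier_mat (dim_row G) (dim_col G)"
    and G: "G = S * G2" and unit: "coeff (det S) 0 dvd 1"
  shows "degree (pred (det S)) = 0"
proof (rule ccontr)
  assume deg: "degree (pred (det S)) \<noteq> 0"
  let ?k = "dim_row G" and ?n = "dim_col G"
  have k: "0 < ?k"
  proof (rule ccontr)
    assume "\<not> 0 < ?k"
    then have "det S = 1" using S by simp
    then show False using deg by simp
  qed
  have "pred (det S) \<noteq> 0" using deg by auto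
  then obtain u where u: "u dvd 1" "degree (u * det S) = degree (pred (det S))"
    "lead_coeff (u * det S) dvd 1" using weierstrass_preparation by blast
  obtain u' where u': "1 = u * u'" using u(1) by (rule dvdE)
  \<comment> \<open>\<open>D\<close> scales the first row by the inverse of \<open>u\<close> and
    \<open>D'\<close> scales it back; this needs at least one row.\<close>
  define D D' where "D = multrow_mat ?k 0 u'" and "D' = multrow_mat ?k 0 u"
  have D: "D \<in> carrier_mat ?k ?k" "D' \<in> carrier_mat ?k ?k" by (auto simp: D_def D'_def)
  have diag: "multrow_mat ?k 0 a * multrow_mat ?k 0 b = 1\<^sub>m ?k" if "a * b = 1" for a b :: "'a poly"
  proof -
    have "multrow_mat ?k 0 a * multrow_mat ?k 0 b = multrow 0 a (multrow_mat ?k 0 b)"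
      by (rule multrow_mat[symmetric, of _ _ ?k]) simp
    also have "\<dots> = 1\<^sub>m ?k" by (rule eq_matI) (use k that in auto)
    finally show ?thesis .
  qed
  have DD': "D * D' = 1\<^sub>m ?k" "D' * D = 1\<^sub>m ?k"
    unfolding D_def D'_def by (rule diag; use u' in \<open>simp add: mult.commute\<close>)+
  define H where "H = D * G2"
  have H: "H \<in> carrier_mat ?k ?n" using D G2 by (simp add: H_def)
  note adj = adj_mat[OF S]
  obtain \<sigma> where \<sigma>: "\<sigma> * poly_to_fls (det S) = 1" using poly_to_fls_unit[OF unit] .
  \<comment> \<open>\<open>M\<close> is \<open>D\<close> times the inverse of \<open>S\<close>,
    written as the adjugate over \<open>det S\<close>, and \<open>N\<close> is its inverse. The
    entries of \<open>M\<close> are rational functions because \<open>det S\<close> has a unit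
    constant coefficient.\<close>
  define M N where "M = \<sigma> \<cdot>\<^sub>m laurent_mat (D * adj_mat S)" and "N = laurent_mat (S * D')"
  have DadjS: "D * adj_mat S \<in> carrier_mat ?k ?k" and SD': "S * D' \<in> carrier_mat ?k ?k"
    using D adj S by auto
  have M: "M \<in> carrier_mat ?k ?k" and N: "N \<in> carrier_mat ?k ?k"
    using DadjS SD' by (auto simp: M_def N_def)
  have cancel: "D * adj_mat S * (S * B) = det S \<cdot>\<^sub>m (D * B)" if B: "B \<in> carrier_mat ?k q" for B q
  proof -
    have "D * adj_mat S * (S * B) = D * (adj_mat S * S * B)"
      using D(1) adj(1) S B by (simp add: assoc_mult_mat[of _ ?k ?k _ ?k _ q])
    also have "\<dots> = det S \<cdot>\<^sub>m (D * B)"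
      unfolding adj(3) using D(1) B
      by (simp add: mult_smult_assoc_mat[of _ ?k ?k _ q] mult_smult_distrib[of _ ?k ?k _ q])
    finally show ?thesis .
  qed
  have \<sigma>cancel: "\<sigma> \<cdot>\<^sub>m laurent_mat (det S \<cdot>\<^sub>m B) = laurent_mat B" for B
    by (rule eq_matI) (use \<sigma> in \<open>auto simp: laurent_mat_def poly_to_fls.hom_mult mult.assoc[symmetric]\<close>)
  have one: "laurent_mat (1\<^sub>m ?k) = (1\<^sub>m ?k :: 'a fls mat)"
    unfolding laurent_mat_def by (rule poly_to_fls.mat_hom_one)
  have "M * N = 1\<^sub>m ?k"
  proof -
    have "M * N = \<sigma> \<cdot>\<^sub>m laurent_mat (D * adj_mat S * (S * D'))"
      unfolding M_def N_def laurent_mat_mult[OF DadjS SD']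
      using DadjS SD' by (intro mult_smult_assoc_mat[of _ ?k ?k _ ?k]) auto
    then show ?thesis unfolding cancel[OF D(2)] \<sigma>cancel DD' one .
  qed
  moreover have "N * M = 1\<^sub>m ?k"
  proof -
    have "N * M = \<sigma> \<cdot>\<^sub>m laurent_mat (S * D' * (D * adj_mat S))"
      unfolding M_def N_def laurent_mat_mult[OF SD' DadjS]
      using DadjS SD' by (intro mult_smult_distrib[of _ ?k ?k _ ?k]) auto
    also have "S * D' * (D * adj_mat S) = S * (D' * D * adj_mat S)"
      using S D adj(1) by (simp add: assoc_mult_mat[of _ ?k ?k _ ?k _ ?k])
    also have "\<dots> = det S \<cdot>\<^sub>m 1\<^sub>m ?k" unfolding DD' using adj by simp
    finally show ?thesis unfolding \<sigma>cancel one .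
  qed
  moreover have "elements_mat M \<subseteq> ratfuns"
  proof -
    have "M $$ (i, j) \<in> ratfuns" if "i < ?k" "j < ?k" for i j
    proof (rule ratfuns_over_unit[OF unit])
      have "M $$ (i, j) = \<sigma> * poly_to_fls ((D * adj_mat S) $$ (i, j))"
        unfolding M_def laurent_mat_def
        using carrier_matD[OF D(1)] carrier_matD[OF adj(1)] that
        by (simp del: index_mult_mat(1))
      then show "M $$ (i, j) * poly_to_fls (det S) = poly_to_fls ((D * adj_mat S) $$ (i, j))"
        using \<sigma> by (simp add: mult.commute mult.left_commute[of "poly_to_fls (det S)"] mult.assoc[symmetric]
          del: index_mult_mat(1))
    qed
    then show ?thesis using M by (auto simp: elements_mat_def)
  qed
  moreover have "elements_mat N \<subseteq> ratfuns"
  proof -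
    have "poly_to_fls a \<in> ratfuns" for a :: "'a poly"
      by (rule ratfuns_over_unit[of 1]) auto
    then show ?thesis using SD' by (auto simp: elements_mat_def N_def laurent_mat_def)
  qed
  ultimately have "nonsingular_ratfun_mat ?k M"
    using M N unfolding nonsingular_ratfun_mat_def by blast
  moreover have "laurent_mat H = M * laurent_mat G"
  proof -
    have "M * laurent_mat G = \<sigma> \<cdot>\<^sub>m laurent_mat (D * adj_mat S * G)"
      unfolding M_def laurent_mat_mult[OF DadjS, of G ?n, simplified]
      using DadjS by (intro mult_smult_assoc_mat[of _ ?k ?k _ ?n]) auto
    also have "D * adj_mat S * G = det S \<cdot>\<^sub>m H" using cancel[OF G2] by (simp add: H_def flip: G)
    finally show ?thesis unfolding \<sigma>cancel by simp
  qed
  ultimately have "internal_degree G \<le> internal_degree H"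
    using red unfolding reduced_internal_degree_encoder_def by blast
  moreover have "internal_degree H < internal_degree G"
  proof -
    have "full_minors H = (*) u' ` full_minors G2"
      unfolding H_def full_minors_mult[OF D(1) G2] using k by (simp add: D_def det_multrow_mat)
    moreover have "full_minors G = (*) (det S) ` full_minors G2"
      by (subst G) (rule full_minors_mult[OF S G2])
    moreover have "u * det S * (u' * w) = det S * w" for w
      using u' by (simp add: ac_simps) (metis mult.assoc mult.commute mult_1)
    ultimately have minors: "full_minors G = (*) (u * det S) ` full_minors H"
      by (simp add: image_image)
    have "full_row_rank G"
      using red by (simp add: reduced_internal_degree_encoder_def encoder_def)
    then obtain m where "m \<in> full_minors (map_mat pred G)" "m \<noteq> 0"
      by (rule nonzero_reduced_minor)
    then obtain m' where "m' \<in> full_minors G" "m' \<noteq> 0"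
      unfolding poly.full_minors_hom by (metis imageE poly.hom_zero)
    with internal_degree_less[OF minors u(3)] u(2) deg show ?thesis by auto
  qed
  ultimately show False by simp
qed

lemma Delta_reduced_if_noncatastrophic:
  assumes C: "encoder C G" and noncat: "noncatastrophic_encoder G"
    and red: "reduced_internal_degree_encoder C G'"
  shows "\<exists>m. Delta G' = [:0, 1:] ^ m"
proof -
  let ?k = "dim_row G'" and ?n = "dim_col G'"
  have C': "encoder C G'" using red by (simp add: reduced_internal_degree_encoder_def)
  have G: "G \<in> carrier_mat ?k ?n"
    using encoder_dim_row_le[OF C C'] encoder_dim_row_le[OF C' C] encoder_dim_col[OF C C']
    by (intro carrier_matI) auto
  have G': "G' \<in> carrier_mat ?k ?n" by simp
  have rank: "full_row_rank G" "full_row_rank G'" using C C' by (auto simp: encoder_def)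
  obtain T where T: "T \<in> carrier_mat ?k ?k" and TG: "laurent_mat G' = T * laurent_mat G"
    and rows: "\<And>i. i < ?k \<Longrightarrow> encode G (row T i) = row (laurent_mat G') i"
    using encoder_transition[OF C C'] G by (metis carrier_matD(1))
  \<comment> \<open>Row \<open>i\<close> of \<open>T\<close> encodes to a polynomial row of
    \<open>G'\<close>, so noncatastrophicity makes it a vector of Laurent polynomials.\<close>
  have "wt (row T i) < \<infinity>" if i: "i < ?k" for i
  proof -
    have "row (laurent_mat G') i = map_vec poly_to_fls (row G' i)"
      using i by (intro eq_vecI) (auto simp: laurent_mat_def)
    then have "wt (encode G (row T i)) < \<infinity>"
      unfolding rows[OF i]
      by (subst wt_finite_iff[of _ ?n]) (auto intro!: exI[of _ 0] bexI[of _ "row G' i"])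
    moreover have "row T i \<in> carrier_vec ?k" using T i by auto
    ultimately show ?thesis using noncat G by (auto simp: noncatastrophic_encoder_def)
  qed
  from finite_weight_mat[OF T this] obtain N T1 where T1: "T1 \<in> carrier_mat ?k ?k"
    and NT: "fls_X ^ N \<cdot>\<^sub>m T = laurent_mat T1" by metis
  define X :: "'a poly" where "X = [:0, 1:] ^ N"
  have T1G: "T1 * G = X \<cdot>\<^sub>m G'"
  proof -
    have "laurent_mat (T1 * G) = fls_X ^ N \<cdot>\<^sub>m laurent_mat G'"
      unfolding laurent_mat_mult[OF T1 G] NT[symmetric] TG
      by (rule mult_smult_assoc_mat[OF T]) (use G in simp)
    also have "\<dots> = laurent_mat (X \<cdot>\<^sub>m G')"
      unfolding laurent_mat_def poly_to_fls.mat_hom_smult by (simp add: X_def poly_to_fls_X_power)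
    finally show ?thesis unfolding laurent_mat_inj .
  qed
  define T1b where "T1b = map_mat pred T1"
  have T1b: "T1b \<in> carrier_mat ?k ?k" using T1 by (simp add: T1b_def)
  have predX: "pred X = [:0, 1:] ^ N" by (simp add: X_def poly.hom_power)
  have minors: "(*) (([:0, 1:] ^ N) ^ ?k) ` full_minors (map_mat pred G') =
      (*) (det T1b) ` full_minors (map_mat pred G)"
  proof -
    have "T1b * map_mat pred G = [:0, 1:] ^ N \<cdot>\<^sub>m map_mat pred G'"
      unfolding T1b_def poly.mat_hom_mult[OF T1 G, symmetric] T1G poly.mat_hom_smult predX ..
    with full_minors_mult[OF T1b, of "map_mat pred G" ?n]
      full_minors_smult[of "map_mat pred G'" ?k ?n "[:0, 1:] ^ N"] G
    show ?thesis by simp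
  qed
  have "det T1b \<noteq> 0"
  proof
    assume zero: "det T1b = 0"
    obtain m where "m \<in> full_minors (map_mat pred G')" "m \<noteq> 0"
      using nonzero_reduced_minor[OF rank(2)] .
    then have "([:0, 1:] ^ N) ^ ?k * m \<in> (*) (det T1b) ` full_minors (map_mat pred G)"
      using minors by auto
    then show False using \<open>m \<noteq> 0\<close> zero by auto
  qed
  from split_off_X_power[OF T1b this] obtain Sb Hb j where Sb: "Sb \<in> carrier_mat ?k ?k"
    and Hb: "Hb \<in> carrier_mat ?k ?k" and SHb: "T1b = Sb * Hb" and Sb0: "poly (det Sb) 0 \<noteq> 0"
    and dHb: "det Hb = [:0, 1:] ^ j" by blast
  \<comment> \<open>\<open>det Hb\<close> is a power of the indeterminate and \<open>det Sb\<close>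
    does not vanish at 0; the resulting Bezout relation is what Hensel lifting needs.\<close>
  have "gcd (det Hb) (det Sb) = 1" using coprime_X_power[OF Sb0, of j] dHb by simp
  then have "fst (bezout_coefficients (det Hb) (det Sb)) * det Hb
      + snd (bezout_coefficients (det Hb) (det Sb)) * det Sb = 1"
    by (simp add: bezout_coefficients_fst_snd)
  from poly.mat_factorization_lift[OF T1 Sb Hb _ this] SHb obtain S H where
    S: "S \<in> carrier_mat ?k ?k" "map_mat pred S = Sb" and H: "H \<in> carrier_mat ?k ?k" and SH: "T1 = S * H"
    unfolding T1b_def by auto
  have dS: "pred (det S) = det Sb" using S(2) poly.hom_det by metis
  have unit: "coeff (det S) 0 dvd 1"
  proof -
    have "red (coeff (det S) 0) = coeff (det Sb) 0"
      unfolding dS[symmetric] by (rule coeff_map_poly[symmetric]) simp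
    then show ?thesis using Sb0 by (simp add: unit_iff poly_0_coeff_0)
  qed
  note adj = adj_mat[OF S(1)]
  have HG: "H * G \<in> carrier_mat ?k ?n" using H G by simp
  have SHG: "S * (H * G) = X \<cdot>\<^sub>m G'"
    using assoc_mult_mat[OF S(1) H G] SH T1G by simp
  \<comment> \<open>The adjugate of \<open>S\<close> moves \<open>S\<close> to the scalar
    \<open>det S\<close>, whose unit constant coefficient cannot contribute to the power
    \<open>X\<close>; hence \<open>X\<close> divides \<open>H * G\<close> itself.\<close>
  have "\<exists>g. (H * G) $$ (l, q) = X * g" if lq: "l < ?k" "q < ?n" for l q
  proof -
    have "det S \<cdot>\<^sub>m (H * G) = adj_mat S * S * (H * G)"
      unfolding adj(3) by (simp only: mult_smult_assoc_mat[OF one_carrier_mat HG] left_mult_one_mat[OF HG])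
    also have "\<dots> = X \<cdot>\<^sub>m (adj_mat S * G')"
      using assoc_mult_mat[OF adj(1) S(1) HG] SHG mult_smult_distrib[OF adj(1) G'] by simp
    finally have "(det S \<cdot>\<^sub>m (H * G)) $$ (l, q) = (X \<cdot>\<^sub>m (adj_mat S * G')) $$ (l, q)" by simp
    then have "det S * (H * G) $$ (l, q) = X * (adj_mat S * G') $$ (l, q)"
      using lq H G adj(1) by (simp del: index_mult_mat(1))
    from X_power_dvd_cancel_unit[OF unit this[unfolded X_def]] show ?thesis
      by (simp add: X_def dvd_def)
  qed
  then obtain g where g: "\<And>l q. l < ?k \<Longrightarrow> q < ?n \<Longrightarrow> (H * G) $$ (l, q) = X * g l q" by metis
  define G2 where "G2 = mat ?k ?n (\<lambda>(l, q). g l q)"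
  have G2: "G2 \<in> carrier_mat ?k ?n" by (simp add: G2_def)
  have HG2: "H * G = X \<cdot>\<^sub>m G2"
    by (rule eq_matI) (use g H G in \<open>auto simp: G2_def simp del: index_mult_mat(1)\<close>)
  have SG2: "G' = S * G2"
  proof (rule eq_matI)
    fix l q assume "l < dim_row (S * G2)" "q < dim_col (S * G2)"
    then have lq: "l < ?k" "q < ?n" using S G2 by auto
    have "X \<cdot>\<^sub>m G' = X \<cdot>\<^sub>m (S * G2)"
      using SHG mult_smult_distrib[OF S(1) G2] by (simp add: HG2)
    then have "(X \<cdot>\<^sub>m G') $$ (l, q) = (X \<cdot>\<^sub>m (S * G2)) $$ (l, q)" by simp
    then have "X * G' $$ (l, q) = X * (S * G2) $$ (l, q)"
      using lq S G2 by (simp del: index_mult_mat(1))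
    then show "G' $$ (l, q) = (S * G2) $$ (l, q)" by (simp only: X_def X_power_mult_cancel)
  qed (use S G2 in auto)
  \<comment> \<open>Here minimality of the internal degree of \<open>G'\<close> enters:
    \<open>S\<close> is a left factor of \<open>G'\<close>.\<close>
  have "degree (det Sb) = 0"
    using reduced_encoder_left_factor[OF red S(1) G2 SG2 unit] dS by simp
  moreover have "det Sb \<noteq> 0" using Sb0 by auto
  ultimately have unitSb: "is_unit (det Sb)" by (simp add: is_unit_iff_degree)
  obtain m where m: "Delta G = [:0, 1:] ^ m" using Delta_if_noncatastrophic[OF rank(1) noncat] by blast
  \<comment> \<open>The factors common to all minors come out of the gcds, so \<open>minors\<close>
    becomes a relation between \<open>Delta G'\<close> and \<open>Delta G\<close>.\<close>
  have "normalize (([:0, 1:] ^ N) ^ ?k * Delta G') = normalize (det T1b * Delta G)"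
    unfolding Gcd_minus_zero Gcd_mult[symmetric] minors ..
  then have "([:0, 1:] ^ N) ^ ?k * Delta G' dvd det T1b * Delta G"
    by (rule associatedD1)
  then have "Delta G' dvd det T1b * Delta G" by (rule dvd_mult_right)
  moreover have "det T1b = det Sb * [:0, 1:] ^ j" using det_mult[OF Sb Hb] SHb dHb by simp
  ultimately have "Delta G' dvd det Sb * ([:0, 1:] ^ j * [:0, 1:] ^ m)"
    by (simp only: m mult.assoc)
  then have "Delta G' dvd [:0, 1:] ^ (j + m)"
    using unitSb by (simp add: dvd_mult_unit_iff' power_add)
  then show ?thesis by (rule dvd_X_power) simp
qed

end

section \<open>Integers modulo a prime power\<close>

lemma of_int_mod_ring_eq_0_iff:
  "(of_int a :: 'q::nontriv mod_ring) = 0 \<longleftrightarrow> int CARD('q) dvd a"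
  unfolding of_int_of_int_mod_ring by transfer (simp add: dvd_eq_mod_eq_0)

lemma reduce_mod_of_int:
  assumes "CARD('p::prime_card) dvd CARD('q::nontriv)"
  shows "reduce_mod (of_int a :: 'q mod_ring) = (of_int a :: 'p mod_ring)"
proof -
  have "to_int_mod_ring (of_int a :: 'q mod_ring) = a mod int CARD('q)"
    unfolding of_int_of_int_mod_ring by transfer simp
  then have "reduce_mod (of_int a :: 'q mod_ring) = (of_int (a mod int CARD('q)) :: 'p mod_ring)"
    by (simp add: reduce_mod_def of_int_of_int_mod_ring)
  moreover have "(of_int (a mod int CARD('q) - a) :: 'p mod_ring) = 0"
    unfolding of_int_mod_ring_eq_0_iff
    using assms by (metis dvd_trans int_dvd_int_iff mod_eq_dvd_iff mod_mod_trivial)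
  ultimately show ?thesis by simp
qed

text \<open>Every residue is the image of an integer, so each property becomes a statement on
  divisibility of integers by powers of \<open>p\<close>.\<close>

lemma chain_reduction_reduce_mod:
  assumes p: "CARD('p::prime_card) = p" and q: "CARD('q::nontriv) = p ^ Suc r"
  shows "chain_reduction (reduce_mod :: 'q mod_ring \<Rightarrow> 'p mod_ring) (of_nat p) (Suc r) (of_nat (p ^ r))"
proof -
  let ?red = "reduce_mod :: 'q mod_ring \<Rightarrow> 'p mod_ring"
  have red: "?red (of_int a) = of_int a" for a
    by (rule reduce_mod_of_int) (simp add: p q)
  have ex: "\<exists>a. x = (of_int a :: 'q mod_ring)" for x
    by (metis of_int_of_int_mod_ring of_int_mod_ring_to_int_mod_ring)
  have ex': "\<exists>a. x = (of_int a :: 'p mod_ring)" for x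
    by (metis of_int_of_int_mod_ring of_int_mod_ring_to_int_mod_ring)
  have p0: "int p \<noteq> 0" using p by auto
  have red0: "?red (of_int a) = 0 \<longleftrightarrow> int p dvd a" for a
    unfolding red of_int_mod_ring_eq_0_iff p ..
  have hom: "comm_ring_hom ?red"
  proof
    show "?red 0 = 0" using red[of 0] by simp
    show "?red 1 = 1" using red[of 1] by simp
    fix x y :: "'q mod_ring"
    obtain a b where ab: "x = of_int a" "y = of_int b" using ex by metis
    show "?red (x + y) = ?red x + ?red y" "?red (x * y) = ?red x * ?red y"
      unfolding ab of_int_add[symmetric] of_int_mult[symmetric] red by simp_all
  qed
  interpret comm_ring_hom ?red by (rule hom)
  have redp: "?red (of_nat p) = 0" using red0[of "int p"] by simp
  show ?thesis
  proof
    have "y \<in> range ?red" for y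
    proof -
      obtain a where "y = of_int a" using ex' by blast
      then show ?thesis using red[of a] by (metis rangeI)
    qed
    then show "surj ?red" by blast
    show "(of_nat p :: 'q mod_ring) ^ Suc r = 0"
      using of_nat_card_eq_0[where 'a = 'q] unfolding q by (simp only: of_nat_power)
    fix x :: "'q mod_ring"
    obtain a where a: "x = of_int a" using ex by blast
    show "?red x = 0 \<longleftrightarrow> of_nat p dvd x"
    proof
      assume "?red x = 0"
      then obtain b where "a = int p * b" using red0 a by (auto simp: dvd_def)
      then show "of_nat p dvd x" by (simp add: a)
    qed (auto simp: dvd_def hom_mult redp)
    show "of_nat (p ^ r) * x = 0 \<longleftrightarrow> ?red x = 0"
    proof -
      have "of_nat (p ^ r) * x = of_int (int p ^ r * a)" by (simp add: a)
      moreover have "int p ^ Suc r dvd int p ^ r * a \<longleftrightarrow> int p dvd a"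
        using p0 by (simp add: mult.commute[of "int p"])
      ultimately show ?thesis unfolding a red0 by (simp only: of_int_mod_ring_eq_0_iff q of_nat_power)
    qed
    show "of_nat (p ^ r) dvd x" if "of_nat p * x = 0"
    proof -
      have "(of_int (int p * a) :: 'q mod_ring) = 0" using that by (simp add: a)
      then have "int p ^ r dvd a" unfolding of_int_mod_ring_eq_0_iff q using p0 by simp
      then obtain b where "a = int p ^ r * b" by (auto simp: dvd_def)
      then show ?thesis by (simp add: a)
    qed
  qed
qed

text \<open>A power of the indeterminate turns \<open>1 / f\<close> into a polynomial exactly when
  \<open>f\<close> divides that power. The zero polynomial is excluded: with the convention
  \<open>1 / 0 = 0\<close> its inverse would have weight 0.\<close>

lemma finite_weight_inverse_iff:
  fixes f :: "'a::field_gcd poly"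
  assumes f: "f \<noteq> 0" and norm: "normalize f = f"
  shows "(\<exists>m. f = [:0, 1:] ^ m) \<longleftrightarrow> fls_wt (1 / poly_to_fls f) < \<infinity>"
  unfolding fls_wt_finite_iff
proof
  assume "\<exists>m. f = [:0, 1:] ^ m"
  then obtain m where "f = [:0, 1:] ^ m" by blast
  then have "fls_X ^ m * (1 / poly_to_fls f) = poly_to_fls 1"
    using f by (simp add: poly_to_fls_X_power[symmetric] del: poly_to_fls.hom_power)
  then show "\<exists>N g. fls_X ^ N * (1 / poly_to_fls f) = poly_to_fls g" by blast
next
  assume "\<exists>N g. fls_X ^ N * (1 / poly_to_fls f) = poly_to_fls g"
  then obtain N g where "fls_X ^ N * (1 / poly_to_fls f) = poly_to_fls g" by blast
  moreover have "poly_to_fls f \<noteq> 0" using f by simp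
  ultimately have "poly_to_fls ([:0, 1:] ^ N) = poly_to_fls (g * f)"
    unfolding poly_to_fls_X_power poly_to_fls.hom_mult by (simp add: field_simps)
  then have "f dvd [:0, 1:] ^ N" by (metis dvd_triv_right poly_to_fls.injectivity)
  then show "\<exists>m. f = [:0, 1:] ^ m" using norm by (rule dvd_X_power)
qed

theorem theorem5p3:
  fixes p r n :: nat
    and C :: "'q :: nontriv mod_ring fls vec set"
  assumes "prime p" and "r \<ge> 1"
    and "CARD('p :: prime_card) = p" and "CARD('q) = p ^ r"
    and "free_convolutional_code n C"
  shows "(\<not> catastrophic_code C \<longleftrightarrow>
            (\<exists>m. (Delta_code C :: 'p mod_ring poly) = [:0, 1:] ^ m)) \<and>
         ((\<exists>m. (Delta_code C :: 'p mod_ring poly) = [:0, 1:] ^ m) \<longleftrightarrow>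
            fls_wt (1 / poly_to_fls (Delta_code C :: 'p mod_ring poly)) < \<infinity>)"
proof -
  obtain r' where r': "r = Suc r'" using assms(2) by (cases r) auto
  interpret chain_reduction "reduce_mod :: 'q mod_ring \<Rightarrow> 'p mod_ring" "of_nat p" "Suc r'" "of_nat (p ^ r')"
    by (rule chain_reduction_reduce_mod) (use assms r' in auto)
  define G where "G = (SOME G. reduced_internal_degree_encoder C G)"
  have red: "reduced_internal_degree_encoder C G"
    unfolding G_def
    using assms(5) reduced_internal_degree_encoder_exists[THEN someI_ex]
    by (auto simp: free_convolutional_code_def)
  then have C: "encoder C G" by (simp add: reduced_internal_degree_encoder_def)
  then have rank: "full_row_rank G" by (simp add: encoder_def)
  have \<Delta>: "Delta_code C = Delta G"
    by (simp add: Delta_code_def Delta_encoder_def G_def reduce_mat_def)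
  \<comment> \<open>From right to left the reduced encoder \<open>G\<close> is itself the
    noncatastrophic witness; from left to right an arbitrary noncatastrophic encoder is compared
    with \<open>G\<close>.\<close>
  have "\<not> catastrophic_code C \<longleftrightarrow> (\<exists>m. Delta G = [:0, 1:] ^ m)"
    using noncatastrophic_if_Delta[of G] C Delta_reduced_if_noncatastrophic[OF _ _ red]
    unfolding catastrophic_code_def by blast
  moreover have "(\<exists>m. Delta G = [:0, 1:] ^ m) \<longleftrightarrow> fls_wt (1 / poly_to_fls (Delta G)) < \<infinity>"
    using Delta_nonzero[OF rank] by (intro finite_weight_inverse_iff) auto
  ultimately show ?thesis unfolding \<Delta> by blast
qed

end
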